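(* For every complete ultrametric field $\mathbb{K}$, $n\in\mathbb{N}$, compact cartesian subset $U\subseteq\mathbb{K}^n$, locally convex topological $\mathbb{K}$-vector space $E$ and $\alpha\in(\mathbb{N}_0\cup\{\infty\})^n$, the space $\mathrm{LocPol}_{\le\alpha}(U,E)$ of $E$-valued locally polynomial functions of multidegree $\le\alpha$ is dense in $C^\alpha(U,E)$.
   Context: An ultrametric field is a field $\mathbb{K}$ with an absolute value $|\cdot|$ satisfying the ultrametric inequality and defining a non-discrete topology; it is complete if the metric $|x-y|$ is complete. All topological vector spaces are Hausdorff. A topological $\mathbb{K}$-vector space $E$ is locally convex if the open $\mathbb{O}$-submodules of $E$ form a basis of $0$-neighbourhoods, where $\mathbb{O}=\{z\in\mathbb{K}:|z|\le1\}$ (equivalently, the topology is defined by ultrametric seminorms). $\mathbb{N}_0=\{0,1,2,\ldots\}$. A function $p\colon U\to E$ on $U\subseteq\mathbb{K}^n$ is a polynomial function of multidegree $\le\alpha$ if there are $a_\beta\in E$ for $\beta\in\mathbb{N}_0^n$ with $\beta\le\alpha$ (componentwise), all but finitely many zero, such that $p(x)=\sum_{\beta\le\alpha}x^\beta a_\beta$ for all $x\in U$, with $x^\beta=x_1^{\beta_1}\cdots x_n^{\beta_n}$. A function $f\colon U\to E$ is locally polynomial of multidegree $\le\alpha$ if each $x\in U$ has an open neighbourhood $V$ in $U$ such that $f|_V$ is a polynomial function of multidegree $\le\alpha$; $\mathrm{LocPol}_{\le\alpha}(U,E)$ is the space of all such $f$. A subset $U\subseteq\mathbb{K}^n$ is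 cartesian if $U=U_1\times\cdots\times U_n$ with subsets $U_i\subseteq\mathbb{K}$ without isolated points. Let $U$ be cartesian, $f\colon U\to E$ and $\beta\in\mathbb{N}_0^n$. Put $U^{<\beta>}:=U_1^{1+\beta_1}\times\cdots\times U_n^{1+\beta_n}$, with elements written $x=(x^{(1)},\ldots,x^{(n)})$, $x^{(i)}=(x^{(i)}_0,\ldots,x^{(i)}_{\beta_i})$, and let $U^{>\beta<}$ be the (dense, open) set of $x\in U^{<\beta>}$ with $x^{(i)}_j\ne x^{(i)}_k$ for all $i$ and $0\le j<k\le\beta_i$. Define $f^{>\beta<}\colon U^{>\beta<}\to E$ by \[ f^{>\beta<}(x)=\sum_{j_1=0}^{\beta_1}\cdots\sum_{j_n=0}^{\beta_n}\Big(\prod_{i=1}^n\ \prod_{k_i\in\{0,\ldots,\beta_i\}\setminus\{j_i\}}\frac{1}{x^{(i)}_{j_i}-x^{(i)}_{k_i}}\Big)f(x^{(1)}_{j_1},\ldots,x^{(n)}_{j_n}) \] (empty products are $1$). For $\alpha\in(\mathbb{N}_0\cup\{\infty\})^n$, $f$ is called $C^\alpha$ if for every $\beta\in\mathbb{N}_0^n$ with $\beta\le\alpha$ the map $f^{>\beta<}$ has a (unique) continuous extension $f^{<\beta>}\colon U^{<\beta>}\to E$. $C^\alpha(U,E)$ is the space of all $C^\alpha$-maps $U\to E$, endowed with the initial topology with respect to the maps $C^\alpha(U,E)\to C(V^{<\beta>},E)$, $f\mapsto(f|_V)^{<\beta>}$, for all $\beta\in\mathbb{N}_0^n$ with $\beta\le\alpha$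 and all cartesian relatively open $V\subseteq U$, where $C(V^{<\beta>},E)$ has the compact-open topology. *)

theory Defs
  imports "HOL-Analysis.Analysis"
begin

(* dist = |x - y| makes the metric topology the one defined by the absolute value;
   perfect_space says that this topology is not discrete. Completeness is the library
   class complete_space. *)
class ultrametric_field = field + metric_space + perfect_space +
  fixes absval :: "'a \<Rightarrow> real"
  assumes absval_nonneg: "0 \<le> absval x"
    and absval_eq_0_iff: "absval x = 0 \<longleftrightarrow> x = 0"
    and absval_mult: "absval (x * y) = absval x * absval y"
    and absval_add_le_max: "absval (x + y) \<le> max (absval x) (absval y)"
    and dist_absval: "dist x y = absval (x - y)"

locale hausdorff_tvs = vector_space smul
  for smul :: "'k::ultrametric_field \<Rightarrow> 'e::{topological_ab_group_add, t2_space} \<Rightarrow> 'e" +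
  assumes continuous_smul: "continuous_on UNIV (\<lambda>(c, x). smul c x)"

definition unit_ball_submodule ::
    "('k::ultrametric_field \<Rightarrow> 'e::ab_group_add \<Rightarrow> 'e) \<Rightarrow> 'e set \<Rightarrow> bool" where
  "unit_ball_submodule smul M \<longleftrightarrow>
     0 \<in> M \<and> (\<forall>x\<in>M. \<forall>y\<in>M. x + y \<in> M) \<and> (\<forall>c. absval c \<le> 1 \<longrightarrow> (\<forall>x\<in>M. smul c x \<in> M))"

locale locally_convex_tvs = hausdorff_tvs smul
  for smul :: "'k::ultrametric_field \<Rightarrow> 'e::{topological_ab_group_add, t2_space} \<Rightarrow> 'e" +
  assumes locally_convex:
    "\<And>W. open W \<Longrightarrow> 0 \<in> W \<Longrightarrow> \<exists>M. open M \<and> unit_ball_submodule smul M \<and> M \<subseteq> W"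

definition cartesian :: "('k::topological_space ^ 'n) set \<Rightarrow> bool" where
  "cartesian U \<longleftrightarrow>
     (\<exists>A. (\<forall>i. \<forall>a. \<not> a isolated_in A i) \<and> U = {x. \<forall>i. x $ i \<in> A i})"

definition multiindex_le :: "('n \<Rightarrow> nat) \<Rightarrow> ('n \<Rightarrow> enat) \<Rightarrow> bool" where
  "multiindex_le \<beta> \<alpha> \<longleftrightarrow> (\<forall>i. enat (\<beta> i) \<le> \<alpha> i)"

definition polynomial_on ::
    "('k::field \<Rightarrow> 'e::ab_group_add \<Rightarrow> 'e) \<Rightarrow> ('n::finite \<Rightarrow> enat) \<Rightarrow> ('k ^ 'n) set \<Rightarrow> ('k ^ 'n \<Rightarrow> 'e) \<Rightarrow> bool"
  where
  "polynomial_on smul \<alpha> U p \<longleftrightarrow>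
     (\<exists>a. finite {\<beta>. multiindex_le \<beta> \<alpha> \<and> a \<beta> \<noteq> 0} \<and>
        (\<forall>x\<in>U. p x = (\<Sum>\<beta> | multiindex_le \<beta> \<alpha> \<and> a \<beta> \<noteq> 0.
                         smul (\<Prod>i\<in>UNIV. (x $ i) ^ \<beta> i) (a \<beta>))))"

(* A function on U is represented by the total function that is undefined outside U
   (extensional U), so that equality of representatives is equality on U. *)
definition LocPol ::
    "('k::ultrametric_field \<Rightarrow> 'e::ab_group_add \<Rightarrow> 'e) \<Rightarrow> ('n::finite \<Rightarrow> enat) \<Rightarrow> ('k ^ 'n) set
      \<Rightarrow> ('k ^ 'n \<Rightarrow> 'e) set" where
  "LocPol smul \<alpha> U =
     {f \<in> extensional U. \<forall>x\<in>U. \<exists>V. openin (top_of_set U) V \<and> x \<in> V \<and> polynomial_on smul \<alpha> V f}"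

(* U^{<\<beta>>}, with x i j in the role of the j-th entry of the i-th block. For cartesian U the
   i-th factor is the i-th projection of U; an empty U need not determine its factors, but then
   U^{<\<beta>>} is empty for any choice.
   The topology is the subspace topology of the product topology on 'n => nat => 'k; the
   coordinates j > \<beta> i are constant on this set. *)
definition node_space :: "('n \<Rightarrow> nat) \<Rightarrow> ('k ^ 'n) set \<Rightarrow> ('n \<Rightarrow> nat \<Rightarrow> 'k) set" where
  "node_space \<beta> U = (\<Pi>\<^sub>E i\<in>UNIV. \<Pi>\<^sub>E j\<in>{..\<beta> i}. (\<lambda>u. u $ i) ` U)"

(* U^{>\<beta><} *)
definition distinct_node_space :: "('n \<Rightarrow> nat) \<Rightarrow> ('k ^ 'n) set \<Rightarrow> ('n \<Rightarrow> nat \<Rightarrow> 'k) set" where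
  "distinct_node_space \<beta> U = {x \<in> node_space \<beta> U. \<forall>i. \<forall>k\<le>\<beta> i. \<forall>j<k. x i j \<noteq> x i k}"

(* f^{>\<beta><}; the sum ranges over the multi-indices j with j i \<le> \<beta> i for all i
   (pointwise order on functions). *)
definition divided_difference ::
    "('k::field \<Rightarrow> 'e::ab_group_add \<Rightarrow> 'e) \<Rightarrow> ('n::finite \<Rightarrow> nat) \<Rightarrow> ('k ^ 'n \<Rightarrow> 'e)
      \<Rightarrow> ('n \<Rightarrow> nat \<Rightarrow> 'k) \<Rightarrow> 'e" where
  "divided_difference smul \<beta> f x =
     (\<Sum>j\<in>{j. \<forall>i. j i \<le> \<beta> i}.
        smul (\<Prod>i\<in>UNIV. \<Prod>k\<in>{..\<beta> i} - {j i}. 1 / (x i (j i) - x i k))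
              (f (\<chi> i. x i (j i))))"

definition continuous_maps ::
    "'a::topological_space set \<Rightarrow> ('a \<Rightarrow> 'e::topological_space) set" where
  "continuous_maps X = {g \<in> extensional X. continuous_on X g}"

definition is_dd_extension ::
    "('k::ultrametric_field \<Rightarrow> 'e::{ab_group_add, topological_space} \<Rightarrow> 'e) \<Rightarrow> ('n::finite \<Rightarrow> nat)
      \<Rightarrow> ('k ^ 'n) set \<Rightarrow> ('k ^ 'n \<Rightarrow> 'e) \<Rightarrow> (('n \<Rightarrow> nat \<Rightarrow> 'k) \<Rightarrow> 'e) \<Rightarrow> bool" where
  "is_dd_extension smul \<beta> U f g \<longleftrightarrow>
     g \<in> continuous_maps (node_space \<beta> U) \<and>
     (\<forall>x\<in>distinct_node_space \<beta> U. g x = divided_difference smul \<beta> f x)"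

(* f^{<\<beta>>}; for cartesian U and Hausdorff 'e there is at most one extension, because U^{>\<beta><}
   is dense in U^{<\<beta>>}. *)
definition dd_extension ::
    "('k::ultrametric_field \<Rightarrow> 'e::{ab_group_add, topological_space} \<Rightarrow> 'e) \<Rightarrow> ('n::finite \<Rightarrow> nat)
      \<Rightarrow> ('k ^ 'n) set \<Rightarrow> ('k ^ 'n \<Rightarrow> 'e) \<Rightarrow> ('n \<Rightarrow> nat \<Rightarrow> 'k) \<Rightarrow> 'e" where
  "dd_extension smul \<beta> U f = (SOME g. is_dd_extension smul \<beta> U f g)"

definition C_alpha ::
    "('k::ultrametric_field \<Rightarrow> 'e::{ab_group_add, topological_space} \<Rightarrow> 'e) \<Rightarrow> ('n::finite \<Rightarrow> enat)
      \<Rightarrow> ('k ^ 'n) set \<Rightarrow> ('k ^ 'n \<Rightarrow> 'e) set" where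
  "C_alpha smul \<alpha> U =
     {f \<in> extensional U. \<forall>\<beta>. multiindex_le \<beta> \<alpha> \<longrightarrow> (\<exists>g. is_dd_extension smul \<beta> U f g)}"

definition compact_open_topology ::
    "'a::topological_space set \<Rightarrow> ('a \<Rightarrow> 'e::topological_space) topology" where
  "compact_open_topology X =
     topology_generated_by
       {{g \<in> continuous_maps X. g ` K \<subseteq> W} | K W. compact K \<and> K \<subseteq> X \<and> open W}"

definition C_alpha_topology ::
    "('k::ultrametric_field \<Rightarrow> 'e::{ab_group_add, topological_space} \<Rightarrow> 'e) \<Rightarrow> ('n::finite \<Rightarrow> enat)
      \<Rightarrow> ('k ^ 'n) set \<Rightarrow> ('k ^ 'n \<Rightarrow> 'e) topology" where
  "C_alpha_topology smul \<alpha> U =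
     topology_generated_by
       {{f \<in> C_alpha smul \<alpha> U. dd_extension smul \<beta> V (restrict f V) \<in> W} | \<beta> V W.
          multiindex_le \<beta> \<alpha> \<and> cartesian V \<and> openin (top_of_set U) V \<and>
          openin (compact_open_topology (node_space \<beta> V)) W}"

lemma topspace_compact_open_topology:
  "topspace (compact_open_topology X) = continuous_maps X"
proof -
  have "continuous_maps X \<in> {{g \<in> continuous_maps X. g ` K \<subseteq> W} | K W. compact K \<and> K \<subseteq> X \<and> open W}"
    by (rule CollectI, intro exI[of _ "{}"] exI[of _ UNIV]) auto
  then show ?thesis
    unfolding compact_open_topology_def topology_generated_by_topspace by blast
qed

lemma topspace_C_alpha_topology:
  fixes smul :: "'k::ultrametric_field \<Rightarrow> 'e::{ab_group_add, topological_space} \<Rightarrow> 'e"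
    and U :: "('k ^ 'n::finite) set"
  assumes "cartesian U"
  shows "topspace (C_alpha_topology smul \<alpha> U) = C_alpha smul \<alpha> U"
proof -
  let ?B = "{{f \<in> C_alpha smul \<alpha> U. dd_extension smul \<beta> V (restrict f V) \<in> W} | \<beta> V W.
          multiindex_le \<beta> \<alpha> \<and> cartesian V \<and> openin (top_of_set U) V \<and>
          openin (compact_open_topology (node_space \<beta> V)) W}"
  have zero: "multiindex_le (\<lambda>_. 0) \<alpha>"
    by (simp add: multiindex_le_def zero_enat_def[symmetric])
  have "dd_extension smul (\<lambda>_. 0) U (restrict f U) \<in> continuous_maps (node_space (\<lambda>_. 0) U)"
    if "f \<in> C_alpha smul \<alpha> U" for f
  proof -
    have "restrict f U = f" "\<exists>g. is_dd_extension smul (\<lambda>_. 0) U f g"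
      using that zero by (auto simp: C_alpha_def extensional_restrict)
    then show ?thesis
      unfolding dd_extension_def by (metis is_dd_extension_def someI_ex)
  qed
  then have "C_alpha smul \<alpha> U = {f \<in> C_alpha smul \<alpha> U.
      dd_extension smul (\<lambda>_. 0) U (restrict f U) \<in> continuous_maps (node_space (\<lambda>_. 0) U)}"
    by blast
  moreover have "openin (compact_open_topology (node_space (\<lambda>_. 0) U))
      (continuous_maps (node_space (\<lambda>_. 0) U) :: (_ \<Rightarrow> 'e) set)"
    by (metis openin_topspace topspace_compact_open_topology)
  ultimately have "C_alpha smul \<alpha> U \<in> ?B"
    using zero assms by (intro CollectI exI conjI) (assumption | simp)+
  then show ?thesis
    unfolding C_alpha_topology_def topology_generated_by_topspace by blast
qed

end

(* Divided differences are symmetric in their nodes, so in each variable they are functions of a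
   finite set S of distinct nodes. Partition a factor of U into balls of radius d, choose k + 1 nodes in
   every ball, and let h be the function that on each ball is the Lagrange interpolant of f, with
   g = f - h. On a ball, g[S] = f[S] - f[C] for |S| = k + 1 is small by uniform continuity. Moving the
   nodes of S into C one at a time gives g[S] = O(d^(k + 1 - |S|)) for smaller S, as g vanishes on C. This
   factor pays for the division by a - b with |a - b| > d when S meets several balls. Hence h is close to f
   in all orders up to k, and interpolation is a contraction for this notion of closeness. So the
   interpolations in the separate variables, for one common d, can be composed, and the composite is
   locally polynomial. *)

theory Submission
  imports Defs "HOL-Computational_Algebra.Polynomial"
begin

text \<open>A neighbourhood in \<open>C_alpha_topology\<close> constrains only finitely many orders.
  So even if \<alpha> has infinite entries, closeness up to some finite order \<open>a\<close>
  suffices, and \<open>a\<close> instead of \<alpha> fixes the number of nodes per ball. Smallness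
  of vectors is membership in an open submodule \<open>M\<close>. As \<open>M\<close> is closed
  under addition, the errors of the successive coordinatewise interpolations add up without
  shrinking \<open>M\<close>. The estimates rest on an exchange identity for distinct nodes. They
  pass to coinciding nodes because tuples of distinct nodes are dense and an open submodule is also
  closed. That locally polynomial functions are C^\<alpha> at all needs its own argument: their
  divided differences must extend continuously to places where some nodes merge while others stay in
  distant balls. On a compact \<open>U\<close> such a function is a finite sum of monomials, with
  coefficients in the target space, times indicators of boxes of balls. This reduces the question to
  one variable, where the clopen balls of an ultrametric field permit continuous cut-offs of the
  inverse.\<close>

section \<open>Divided differences over finite node sets\<close>

(* The nodes form a finite set, since for distinct nodes their order does not matter. *)
definition dd :: "('k::field \<Rightarrow> 'e::ab_group_add \<Rightarrow> 'e) \<Rightarrow> ('k \<Rightarrow> 'e) \<Rightarrow> 'k set \<Rightarrow> 'e" where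
  "dd smul F S = (\<Sum>s\<in>S. smul (\<Prod>t\<in>S - {s}. 1 / (s - t)) (F s))"

lemma dd_empty [simp]: "dd smul F {} = 0"
  by (simp add: dd_def)

lemma dd_cong: "(\<And>s. s \<in> S \<Longrightarrow> F s = G s) \<Longrightarrow> dd smul F S = dd smul G S"
  by (simp add: dd_def)

context vector_space
begin

lemma dd_singleton [simp]: "dd scale F {a} = F a"
  by (simp add: dd_def)

lemma dd_insert:
  assumes "finite S" "a \<notin> S"
  shows "dd scale F (insert a S) = scale (\<Prod>t\<in>S. 1 / (a - t)) (F a) +
     (\<Sum>s\<in>S. scale (1 / (s - a) * (\<Prod>t\<in>S - {s}. 1 / (s - t))) (F s))"
proof -
  have "(\<Prod>t\<in>insert a S - {s}. 1 / (s - t)) = 1 / (s - a) * (\<Prod>t\<in>S - {s}. 1 / (s - t))"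
    if "s \<in> S" for s
  proof -
    have "insert a S - {s} = insert a (S - {s})"
      using that assms by blast
    then show ?thesis
      using assms by simp
  qed
  then show ?thesis
    using assms by (simp add: dd_def cong: sum.cong)
qed

text \<open>The classical recursion for divided differences, multiplied out. It follows from the
  partial fraction identity for \<open>1 / (s - a) - 1 / (s - b)\<close> at each common node. Read
  in one direction it moves a node, read in the other it reduces the number of nodes.\<close>

lemma dd_exchange:
  assumes "finite S" "a \<notin> S" "b \<notin> S" "a \<noteq> b"
  shows "dd scale F (insert a S) - dd scale F (insert b S) =
    scale (a - b) (dd scale F (insert a (insert b S)))"
proof -
  define w where "w s = (\<Prod>t\<in>S - {s}. 1 / (s - t))" for s
  have *: "1 / (s - a) * w s - 1 / (s - b) * w s = (a - b) * (1 / (s - a) * (1 / (s - b) * w s))"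
    if "s \<in> S" for s
  proof -
    have "s - a \<noteq> 0" "s - b \<noteq> 0"
      using that assms by auto
    then have "1 / (s - a) - 1 / (s - b) = (a - b) * (1 / (s - a) * (1 / (s - b)))"
      by (simp add: field_simps)
    then show ?thesis
      by (metis (no_types, opaque_lifting) left_diff_distrib mult.assoc)
  qed
  have ww: "(\<Prod>t\<in>insert b S - {s}. 1 / (s - t)) = 1 / (s - b) * w s" if "s \<in> S" for s
  proof -
    have "insert b S - {s} = insert b (S - {s})"
      using that assms by blast
    then show ?thesis
      using assms by (simp add: w_def)
  qed
  have ab: "a - b \<noteq> 0" "b - a \<noteq> 0"
    using assms by auto
  have "(\<Sum>s\<in>S. scale (1 / (s - a) * (\<Prod>t\<in>insert b S - {s}. 1 / (s - t))) (F s)) =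
      (\<Sum>s\<in>S. scale (1 / (s - a) * (1 / (s - b) * w s)) (F s))"
    by (intro sum.cong refl) (simp only: ww)
  moreover have "insert b S - {b} = S"
    using assms by simp
  ultimately have "dd scale F (insert a (insert b S)) =
      scale (1 / (a - b) * (\<Prod>t\<in>S. 1 / (a - t))) (F a) +
      (scale (1 / (b - a) * (\<Prod>t\<in>S. 1 / (b - t))) (F b) +
      (\<Sum>s\<in>S. scale (1 / (s - a) * (1 / (s - b) * w s)) (F s)))"
    using assms by (subst dd_insert) simp_all
  moreover have "dd scale F (insert a S) = scale (\<Prod>t\<in>S. 1 / (a - t)) (F a) +
     (\<Sum>s\<in>S. scale (1 / (s - a) * w s) (F s))"
    using assms by (subst dd_insert) (auto simp: w_def)
  moreover have "dd scale F (insert b S) = scale (\<Prod>t\<in>S. 1 / (b - t)) (F b) +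
     (\<Sum>s\<in>S. scale (1 / (s - b) * w s) (F s))"
    using assms by (subst dd_insert) (auto simp: w_def)
  moreover have "(\<Sum>s\<in>S. scale (1 / (s - a) * w s) (F s)) - (\<Sum>s\<in>S. scale (1 / (s - b) * w s) (F s)) =
     (\<Sum>s\<in>S. scale ((a - b) * (1 / (s - a) * (1 / (s - b) * w s))) (F s))"
    unfolding sum_subtractf[symmetric]
    by (intro sum.cong refl) (simp only: scale_left_diff_distrib[symmetric] *)
  moreover have "(a - b) * (1 / (b - a) * p) = - p" for p
  proof -
    have "(a - b) * (1 / (b - a)) = -1"
      using ab(2) by (simp add: divide_eq_eq)
    then show ?thesis
      by (metis mult.assoc mult_minus1)
  qed
  moreover have "(a - b) * (1 / (a - b) * p) = p" for p
    using ab by simp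
  ultimately show ?thesis
    by (simp only: scale_right_distrib scale_sum_right scale_scale scale_minus_left) (simp add: algebra_simps)
qed

lemma dd_add: "dd scale (\<lambda>t. F t + G t) S = dd scale F S + dd scale G S"
  by (simp add: dd_def scale_right_distrib sum.distrib)

lemma dd_diff: "dd scale (\<lambda>t. F t - G t) S = dd scale F S - dd scale G S"
  by (simp add: dd_def scale_right_diff_distrib sum_subtractf)

lemma dd_sum: "dd scale (\<lambda>t. \<Sum>c\<in>C. F c t) S = (\<Sum>c\<in>C. dd scale (F c) S)"
  unfolding dd_def scale_sum_right by (rule sum.swap)

lemma dd_scale: "dd scale (\<lambda>t. scale c (F t)) S = scale c (dd scale F S)"
  by (simp add: dd_def scale_sum_right mult.commute)

lemma dd_scale_left: "dd scale (\<lambda>t. scale (\<phi> t) e) S = scale (dd (*) \<phi> S) e"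
  by (simp add: dd_def scale_sum_left)

text \<open>The factor \<open>t - a\<close> kills the term at \<open>a\<close> and cancels
  \<open>1 / (s - a)\<close> in every other term.\<close>

lemma dd_linear_mult:
  assumes "finite S" "a \<notin> S"
  shows "dd scale (\<lambda>t. scale (t - a) (F t)) (insert a S) = dd scale F S"
proof -
  have "1 / (s - a) * p * (s - a) = p" if "s \<in> S" for s p
  proof -
    have "s - a \<noteq> 0"
      using that assms by auto
    then show ?thesis
      by simp
  qed
  then show ?thesis
    unfolding dd_insert[OF assms] by (simp add: dd_def)
qed

text \<open>The Leibniz rule for a product with the identity, obtained by writing
  \<open>t = (t - a) + a\<close>.\<close>

lemma dd_mult_ident:
  assumes "finite S" "a \<notin> S"
  shows "dd scale (\<lambda>t. scale t (F t)) (insert a S) = dd scale F S + scale a (dd scale F (insert a S))"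
  using dd_linear_mult[OF assms, of F]
  by (simp add: scale_left_diff_distrib dd_diff dd_scale algebra_simps)

lemma dd_const:
  assumes "finite S" "card S \<ge> 2"
  shows "dd scale (\<lambda>_. c) S = 0"
proof -
  have "dd scale (\<lambda>_. c) S = 0" if "card S = Suc (Suc n)" "finite S" for n S
    using that
  proof (induction n arbitrary: S)
    case 0
    then obtain a b where "S = {a, b}" "a \<noteq> b"
      by (auto simp: card_Suc_eq)
    then show ?case
      using dd_exchange[of "{}" a b "\<lambda>_. c"] by simp
  next
    case (Suc n)
    obtain a S1 where 1: "S = insert a S1" "a \<notin> S1" "card S1 = Suc (Suc n)"
      using Suc.prems(1) by (metis card_Suc_eq)
    obtain b S2 where 2: "S1 = insert b S2" "b \<notin> S2" "card S2 = Suc n"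
      using 1(3) by (metis card_Suc_eq)
    have "finite S2"
      using Suc.prems(2) 1 2 by simp
    then have "scale (a - b) (dd scale (\<lambda>_. c) S) = 0 - 0"
      using 1 2 Suc.prems dd_exchange[of S2 a b "\<lambda>_. c"] by (simp add: Suc.IH)
    then show ?case
      using 1 2 by simp
  qed
  then show ?thesis
    using assms by (metis add_2_eq_Suc le_Suc_ex)
qed

end

section \<open>Nodal polynomials and Lagrange interpolation\<close>

lemma vector_space_mult: "vector_space ((*) :: 'k::field \<Rightarrow> 'k \<Rightarrow> 'k)"
  by (rule vector_space_over_itself.vector_space_axioms)

text \<open>A divided difference of order equal to the degree yields the leading coefficient of a
  polynomial, and higher orders yield 0. For the induction a node \<open>s\<close> is used to write
  \<open>t - a = (t - s) + (s - a)\<close>: the first part removes the node \<open>s\<close>, and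
  the second has too many nodes for its degree.\<close>

lemma dd_nodal_polynomial:
  fixes D S :: "'k::field set"
  assumes "finite D" "finite S" "card D < card S"
  shows "dd (*) (\<lambda>t. \<Prod>d\<in>D. t - d) S = (if card S = Suc (card D) then 1 else 0)"
  using assms
proof (induction D arbitrary: S rule: finite_induct)
  case empty
  show ?case
  proof (cases "card S = 1")
    case True
    then show ?thesis
      by (auto simp: card_Suc_eq dd_def)
  next
    case False
    then show ?thesis
      using empty vector_space.dd_const[OF vector_space_mult, of S 1] by simp
  qed
next
  case (insert a D)
  then have "S \<noteq> {}"
    by auto
  then obtain s S' where S: "S = insert s S'" "s \<notin> S'"
    by (metis ex_in_conv mk_disjoint_insert)
  let ?\<psi> = "\<lambda>t. \<Prod>d\<in>D. t - d"
  have fin: "finite S'" and card: "card S = Suc (card S')"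
    using S insert.prems by auto
  have "dd (*) (\<lambda>t. \<Prod>d\<in>insert a D. t - d) S =
      dd (*) (\<lambda>t. (t - s) * ?\<psi> t) S + (s - a) * dd (*) ?\<psi> S"
    using insert.hyps
    by (simp add: vector_space.dd_add[OF vector_space_mult, symmetric]
        vector_space.dd_scale[OF vector_space_mult, symmetric] algebra_simps)
  also have "dd (*) (\<lambda>t. (t - s) * ?\<psi> t) S = dd (*) ?\<psi> S'"
    unfolding S(1) using vector_space.dd_linear_mult[OF vector_space_mult fin S(2)] .
  also have "\<dots> = (if card S' = Suc (card D) then 1 else 0)"
    using insert card fin by (intro insert.IH) auto
  also have "dd (*) ?\<psi> S = 0"
    using insert card by (subst insert.IH) auto
  finally show ?case
    using insert.hyps card by simp
qed

definition lagrange_basis :: "'k::field set \<Rightarrow> 'k \<Rightarrow> 'k \<Rightarrow> 'k" where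
  "lagrange_basis C c t = (\<Prod>d\<in>C - {c}. (t - d) / (c - d))"

definition lagrange :: "('k::field \<Rightarrow> 'e::ab_group_add \<Rightarrow> 'e) \<Rightarrow> 'k set \<Rightarrow> ('k \<Rightarrow> 'e) \<Rightarrow> 'k \<Rightarrow> 'e" where
  "lagrange smul C F t = (\<Sum>c\<in>C. smul (lagrange_basis C c t) (F c))"

lemma (in vector_space) lagrange_node:
  assumes "finite C" "t \<in> C"
  shows "lagrange scale C F t = F t"
proof -
  have "lagrange_basis C c t = (if c = t then 1 else 0)" if "c \<in> C" for c
  proof (cases "c = t")
    case True
    have "(t - d) / (t - d) = 1" if "d \<in> C - {t}" for d
      using that by (metis DiffD2 divide_self eq_iff_diff_eq_0 insertI1)
    then show ?thesis
      using True by (simp add: lagrange_basis_def)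
  next
    case False
    then have "\<exists>d\<in>C - {c}. (t - d) / (c - d) = 0"
      using assms by (intro bexI[of _ t]) auto
    then show ?thesis
      using False assms unfolding lagrange_basis_def by (subst prod_zero) auto
  qed
  then have "lagrange scale C F t = (\<Sum>c\<in>C. if c = t then F t else 0)"
    unfolding lagrange_def by (intro sum.cong) auto
  then show ?thesis
    using assms by simp
qed

text \<open>The top divided difference of the interpolant is its leading coefficient, so it depends
  on \<open>C\<close> but not on the position of the nodes \<open>S\<close>. This is what makes the
  top-order error a difference of two divided differences of \<open>F\<close> itself.\<close>

lemma (in vector_space) dd_lagrange:
  assumes "finite C" "finite S" "card S = card C"
  shows "dd scale (lagrange scale C F) S = dd scale F C"
proof -
  have "dd (*) (lagrange_basis C c) S = (\<Prod>d\<in>C - {c}. 1 / (c - d))" if "c \<in> C" for c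
  proof -
    have "lagrange_basis C c = (\<lambda>t. (\<Prod>d\<in>C - {c}. 1 / (c - d)) * (\<Prod>d\<in>C - {c}. t - d))"
      by (auto simp: lagrange_basis_def prod_dividef)
    moreover have "dd (*) (\<lambda>t. \<Prod>d\<in>C - {c}. t - d) S = 1"
    proof -
      have "card C > 0"
        using that assms card_gt_0_iff by blast
      then show ?thesis
        using that assms by (subst dd_nodal_polynomial) auto
    qed
    ultimately show ?thesis
      by (simp add: vector_space.dd_scale[OF vector_space_mult])
  qed
  then show ?thesis
    unfolding lagrange_def dd_sum dd_scale_left by (simp add: dd_def)
qed

lemma lagrange_basis_polynomial:
  fixes C :: "'k::field set"
  assumes "finite C" "c \<in> C" "card C = Suc k"
  shows "\<exists>l. \<forall>t. lagrange_basis C c t = (\<Sum>m\<le>k. l m * t ^ m)"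
proof -
  define p where "p = (\<Prod>d\<in>C - {c}. [:- d / (c - d), 1 / (c - d):])"
  have "degree p \<le> (\<Sum>d\<in>C - {c}. degree [:- d / (c - d), 1 / (c - d):])"
    unfolding p_def using degree_prod_sum_le[of "C - {c}" "\<lambda>d. [:- d / (c - d), 1 / (c - d):]"] assms
    by (simp add: o_def)
  also have "\<dots> \<le> (\<Sum>d\<in>C - {c}. 1)"
    by (intro sum_mono) auto
  finally have deg: "degree p \<le> k"
    using assms by simp
  have "poly p t = lagrange_basis C c t" for t
    unfolding p_def lagrange_basis_def poly_prod
    by (intro prod.cong refl) (simp add: diff_divide_distrib)
  moreover have "poly p t = (\<Sum>m\<le>k. coeff p m * t ^ m)" for t
    unfolding poly_altdef using deg
    by (intro sum.mono_neutral_left) (auto simp: coeff_eq_0)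
  ultimately show ?thesis
    by metis
qed

section \<open>The error of local interpolation in one variable\<close>

lemma absval_0 [simp]: "absval (0::'k::ultrametric_field) = 0"
  by (simp add: absval_eq_0_iff)

lemma absval_1 [simp]: "absval (1::'k::ultrametric_field) = 1"
  using absval_mult[of "1::'k" 1] absval_eq_0_iff[of "1::'k"] by simp

lemma absval_minus [simp]: "absval (- x) = absval (x::'k::ultrametric_field)"
  by (metis diff_0 diff_0_right dist_absval dist_commute)

lemma absval_inverse: "absval (inverse x) = inverse (absval (x::'k::ultrametric_field))"
proof (cases "x = 0")
  case False
  then have "absval x * absval (inverse x) = 1"
    by (simp flip: absval_mult)
  then show ?thesis
    by (simp add: inverse_unique)
qed auto

lemma absval_divide: "absval (x / y) = absval x / absval (y::'k::ultrametric_field)"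
  by (simp add: divide_inverse absval_mult absval_inverse)

lemma dist_ultrametric: "dist x z \<le> max (dist x y) (dist y (z::'k::ultrametric_field))"
  using absval_add_le_max[of "x - y" "y - z"] by (simp add: dist_absval)

text \<open>Makes \<open>dist x y \<le> r\<close> a transitive relation, so closed balls of radius
  \<open>r\<close> are the classes of an equivalence.\<close>

lemma dist_ultrametric_le:
  "dist x y \<le> r \<Longrightarrow> dist y z \<le> r \<Longrightarrow> dist x (z::'k::ultrametric_field) \<le> r"
  using dist_ultrametric[of x z y] by simp

(* Plays the role of r * M: the value group of the field need not contain r. *)
definition scaled_submodule :: "('k::ultrametric_field \<Rightarrow> 'e::ab_group_add \<Rightarrow> 'e) \<Rightarrow> real \<Rightarrow> 'e set \<Rightarrow> 'e set"
  where "scaled_submodule smul r M = {smul c m |c m. absval c \<le> r \<and> m \<in> M}"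

locale ultrametric_vector_space = vector_space smul
  for smul :: "'k::ultrametric_field \<Rightarrow> 'e::ab_group_add \<Rightarrow> 'e"
begin

lemma submodule_diff:
  assumes "unit_ball_submodule smul M" "x \<in> M" "y \<in> M"
  shows "x - y \<in> M"
proof -
  have "smul (-1) y \<in> M"
    using assms unfolding unit_ball_submodule_def by (metis absval_1 absval_minus order_refl)
  then have "x + smul (-1) y \<in> M"
    using assms unfolding unit_ball_submodule_def by blast
  then show ?thesis
    by simp
qed

lemma scaled_submodule_le_1:
  assumes "unit_ball_submodule smul M" "r \<le> 1"
  shows "scaled_submodule smul r M \<subseteq> M"
  using assms unfolding scaled_submodule_def unit_ball_submodule_def by fastforce

lemma subset_scaled_submodule_1: "M \<subseteq> scaled_submodule smul 1 M"
  unfolding scaled_submodule_def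
  by (rule subsetI, rule CollectI, rule exI[of _ 1], rule exI) auto

lemma smul_mem_scaled_submodule:
  assumes "x \<in> scaled_submodule smul r M" "absval c \<le> d"
  shows "smul c x \<in> scaled_submodule smul (d * r) M"
proof -
  obtain b m where "x = smul b m" "absval b \<le> r" "m \<in> M"
    using assms by (auto simp: scaled_submodule_def)
  moreover have "absval (c * b) \<le> d * r"
    unfolding absval_mult using assms \<open>absval b \<le> r\<close> absval_nonneg
    by (meson mult_mono order_trans)
  ultimately show ?thesis
    by (auto simp: scaled_submodule_def)
qed

text \<open>For a sum, the scalar of larger absolute value is factored out. The quotient of the two
  scalars then has absolute value at most 1 and is absorbed by \<open>M\<close>.\<close>

lemma scaled_submodule:
  assumes M: "unit_ball_submodule smul M" and "0 \<le> r"
  shows "unit_ball_submodule smul (scaled_submodule smul r M)"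
proof -
  have *: "smul c m + smul d n \<in> scaled_submodule smul r M"
    if "m \<in> M" "n \<in> M" "absval c \<le> absval d" "absval d \<le> r" for c d m n
  proof (cases "d = 0")
    case True
    then have "c = 0"
      using that absval_nonneg[of c] by (simp add: absval_eq_0_iff)
    then have "smul c m + smul d n = smul 0 m" "absval (0::'k) \<le> r"
      using True assms by auto
    then show ?thesis
      using that unfolding scaled_submodule_def by blast
  next
    case False
    then have "absval d > 0"
      using absval_nonneg[of d] by (simp add: absval_eq_0_iff order_less_le)
    then have "smul (c / d) m \<in> M"
      using that M unfolding unit_ball_submodule_def by (simp add: absval_divide)
    then have "smul (c / d) m + n \<in> M"
      using that M unfolding unit_ball_submodule_def by blast
    moreover have "smul c m + smul d n = smul d (smul (c / d) m + n)"
      using False by (simp add: scale_right_distrib)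
    ultimately show ?thesis
      using that unfolding scaled_submodule_def by blast
  qed
  have "x + y \<in> scaled_submodule smul r M"
    if xy: "x \<in> scaled_submodule smul r M" "y \<in> scaled_submodule smul r M" for x y
  proof -
    obtain c m d n where "x = smul c m" "y = smul d n" "m \<in> M" "n \<in> M" "absval c \<le> r" "absval d \<le> r"
      using xy unfolding scaled_submodule_def by blast
    then show ?thesis
      using *[of m n c d] *[of n m d c] by (metis add.commute linear)
  qed
  moreover have "0 \<in> scaled_submodule smul r M"
    using M \<open>0 \<le> r\<close> unfolding scaled_submodule_def unit_ball_submodule_def
    by (intro CollectI exI[of _ 0]) auto
  ultimately show ?thesis
    using smul_mem_scaled_submodule[of _ r M _ 1] unfolding unit_ball_submodule_def by auto
qed

end

text \<open>Attaching the node set to every point and requiring it to be constant on balls avoids an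
  index set for the balls. \<open>Suc k\<close> nodes per ball give interpolants of degree at most
  \<open>k\<close>.\<close>

locale local_interpolation = ultrametric_vector_space smul
  for smul :: "'k::ultrametric_field \<Rightarrow> 'e::ab_group_add \<Rightarrow> 'e" +
  fixes A :: "'k set" and \<delta> :: real and k :: nat and C :: "'k \<Rightarrow> 'k set"
  assumes \<delta>: "0 < \<delta>" "\<delta> \<le> 1"
    and finite_nodes: "t \<in> A \<Longrightarrow> finite (C t)"
    and card_nodes: "t \<in> A \<Longrightarrow> card (C t) = Suc k"
    and nodes_subset: "t \<in> A \<Longrightarrow> C t \<subseteq> A"
    and nodes_dist: "t \<in> A \<Longrightarrow> s \<in> C t \<Longrightarrow> dist s t \<le> \<delta>"
    and nodes_eq: "t \<in> A \<Longrightarrow> s \<in> A \<Longrightarrow> dist s t \<le> \<delta> \<Longrightarrow> C s = C t"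
begin

text \<open>\<open>n\<close> counts how many nodes are missing from \<open>Suc k\<close>. The outer
  induction on \<open>n\<close> goes down from the full number of nodes, where the hypothesis on
  \<open>F\<close> applies; each missing node contributes a factor \<delta>.\<close>

lemma dd_error_same_ball:
  assumes M: "unit_ball_submodule smul M" and t: "t \<in> A"
    and F: "\<And>S. finite S \<Longrightarrow> S \<subseteq> A \<Longrightarrow> card S = Suc k \<Longrightarrow> (\<And>s. s \<in> S \<Longrightarrow> dist s t \<le> \<delta>) \<Longrightarrow>
      dd smul F S - dd smul F (C t) \<in> M"
    and S: "finite S" "S \<subseteq> A" "\<And>s. s \<in> S \<Longrightarrow> dist s t \<le> \<delta>" "card S + n = Suc k"
  shows "dd smul (\<lambda>t. F t - lagrange smul (C t) F t) S \<in> scaled_submodule smul (\<delta> ^ n) M"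
  using S
proof (induction n arbitrary: S)
  case 0
  \<comment> \<open>Inside one ball all node sets \<open>C s\<close> equal \<open>C t\<close>, so
    the piecewise interpolant is a single polynomial there and \<open>dd_lagrange\<close>
    applies.\<close>
  have "dd smul (\<lambda>t. F t - lagrange smul (C t) F t) S = dd smul (\<lambda>s. F s - lagrange smul (C t) F s) S"
    using nodes_eq[OF t] 0 by (intro dd_cong) auto
  also have "\<dots> = dd smul F S - dd smul F (C t)"
    using 0 t by (simp add: dd_diff dd_lagrange finite_nodes card_nodes)
  finally show ?case
    using F[of S] 0 subset_scaled_submodule_1[of M] by auto
next
  case (Suc n)
  let ?g = "\<lambda>t. F t - lagrange smul (C t) F t"
  have "unit_ball_submodule smul (scaled_submodule smul (\<delta> ^ Suc n) M)" (is "unit_ball_submodule smul ?N")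
    using scaled_submodule M \<delta> by simp
  then have N: "0 \<in> ?N" "\<And>x y. x \<in> ?N \<Longrightarrow> y \<in> ?N \<Longrightarrow> x + y \<in> ?N"
    unfolding unit_ball_submodule_def by auto
  note IH = Suc.IH
  \<comment> \<open>The inner induction is on the number of nodes outside \<open>C t\<close>. Each
    exchange lowers it by one, and when it is 0 the error vanishes at every node.\<close>
  show ?case
    using Suc.prems
  proof (induction "card (S - C t)" arbitrary: S)
    case 0
    have "?g s = 0" if "s \<in> S" for s
    proof -
      have "s \<in> C t"
        using 0 that by auto
      moreover have "C s = C t"
        using nodes_eq[OF t] 0 that by auto
      ultimately show ?thesis
        using t by (simp add: lagrange_node finite_nodes)
    qed
    then have "dd smul ?g S = 0"
      by (simp add: dd_def)
    then show ?case
      using N by simp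
  next
    case (Suc m S)
    have "S - C t \<noteq> {}"
      using Suc.hyps(2) by (metis card.empty nat.distinct(1))
    then obtain a S' where a: "a \<notin> C t" "S = insert a S'" "a \<notin> S'"
      by (metis DiffE ex_in_conv mk_disjoint_insert)
    \<comment> \<open>At least one node is missing, so \<open>S\<close> has at most \<open>k\<close>
      elements while \<open>C t\<close> has \<open>Suc k\<close>. Hence a free node of
      \<open>C t\<close> remains for the exchange.\<close>
    have "\<not> C t \<subseteq> S"
      using card_mono[of S "C t"] Suc.prems card_nodes[OF t] by auto
    then obtain b where b: "b \<in> C t" "b \<notin> S"
      by blast
    have fS': "finite S'" and ab: "a \<noteq> b" "b \<notin> S'" "a \<in> A" "b \<in> A"
      using a b Suc.prems nodes_subset[OF t] by auto
    have bt: "dist b t \<le> \<delta>"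
      using b t nodes_dist by auto
    have "S - C t = insert a (S' - C t)" "insert b S' - C t = S' - C t"
      using a b by auto
    then have cm: "m = card (insert b S' - C t)"
      using a fS' Suc.hyps(2) by simp
    have 1: "dd smul ?g (insert b S') \<in> ?N"
      using Suc.prems a b bt ab fS' cm by (intro Suc.hyps(1)) auto
    have 2: "dd smul ?g (insert a (insert b S')) \<in> scaled_submodule smul (\<delta> ^ n) M"
      using Suc.prems a b bt ab fS' by (intro IH) auto
    have "absval (a - b) \<le> \<delta>"
      using bt Suc.prems(3)[of a] a by (metis dist_absval dist_commute dist_ultrametric_le insertI1)
    then have "smul (a - b) (dd smul ?g (insert a (insert b S'))) \<in> ?N"
      using smul_mem_scaled_submodule[OF 2, of "a - b" \<delta>] by simp
    moreover have "dd smul ?g S = dd smul ?g (insert b S') +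
        smul (a - b) (dd smul ?g (insert a (insert b S')))"
      using dd_exchange[of S' a b ?g] a b ab fS' by (simp add: algebra_simps)
    ultimately show ?case
      using 1 N by simp
  qed
qed

text \<open>The claim is strengthened to a bound by \<open>\<delta> ^ n\<close> with
  \<open>n\<close> missing nodes, and the induction goes up in the number of nodes. If
  \<open>a\<close> and \<open>b\<close> are more than \<delta> apart, deleting either one leaves a
  set with one more missing node, hence a spare factor \<delta>; division by \<open>a - b\<close>
  costs at most \<open>1 / \<delta>\<close>. A set without such a pair lies in the ball around any
  of its points.\<close>

lemma dd_error:
  assumes M: "unit_ball_submodule smul M"
    and F: "\<And>t S. t \<in> A \<Longrightarrow> finite S \<Longrightarrow> S \<subseteq> A \<Longrightarrow> card S = Suc k \<Longrightarrow>
      (\<And>s. s \<in> S \<Longrightarrow> dist s t \<le> \<delta>) \<Longrightarrow> dd smul F S - dd smul F (C t) \<in> M"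
    and S: "finite S" "S \<subseteq> A" "card S \<le> Suc k"
  shows "dd smul (\<lambda>t. F t - lagrange smul (C t) F t) S \<in> M"
proof -
  let ?g = "\<lambda>t. F t - lagrange smul (C t) F t"
  have "dd smul ?g S \<in> scaled_submodule smul (\<delta> ^ n) M" if "card S + n = Suc k" for n
    using S that
  proof (induction "card S" arbitrary: S n)
    case 0
    then have "dd smul ?g S = 0"
      by simp
    then show ?case
      using scaled_submodule[OF M, of "\<delta> ^ n"] \<delta> by (simp add: unit_ball_submodule_def)
  next
    case (Suc m S n)
    show ?case
    proof (cases "\<exists>a\<in>S. \<exists>b\<in>S. dist a b > \<delta>")
      case True
      then obtain a b where ab: "a \<in> S" "b \<in> S" "dist a b > \<delta>"
        by blast
      define S' where "S' = S - {a, b}"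
      have "a \<noteq> b"
        using ab \<delta> by auto
      then have S': "S = insert a (insert b S')" "a \<notin> insert b S'" "b \<notin> insert a S'" "finite S'"
        using ab Suc.prems by (auto simp: S'_def)
      have ab': "dist a b > 0" "a - b \<noteq> 0"
        using ab \<delta> by auto
      have "dd smul ?g (insert a S') \<in> scaled_submodule smul (\<delta> ^ Suc n) M"
        "dd smul ?g (insert b S') \<in> scaled_submodule smul (\<delta> ^ Suc n) M"
        using S' Suc.prems Suc.hyps(2) by (intro Suc.hyps(1); auto)+
      then have "dd smul ?g (insert a S') - dd smul ?g (insert b S') \<in>
          scaled_submodule smul (\<delta> ^ Suc n) M"
        by (rule submodule_diff[OF scaled_submodule[OF M], rotated]) (use \<delta> in simp)
      moreover have "dd smul ?g (insert a S') - dd smul ?g (insert b S') = smul (a - b) (dd smul ?g S)"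
        using S' dd_exchange[of S' a b ?g] by simp
      ultimately have "smul (a - b) (dd smul ?g S) \<in> scaled_submodule smul (\<delta> ^ Suc n) M"
        by (simp only:)
      moreover have "absval (1 / (a - b)) \<le> 1 / \<delta>"
        using ab \<delta> ab' by (simp add: absval_divide flip: dist_absval) (simp add: frac_le)
      ultimately have "smul (1 / (a - b)) (smul (a - b) (dd smul ?g S)) \<in>
          scaled_submodule smul (1 / \<delta> * \<delta> ^ Suc n) M"
        by (rule smul_mem_scaled_submodule)
      then show ?thesis
        using ab' \<delta> by simp
    next
      case False
      obtain t where t: "t \<in> S"
        using Suc.hyps(2) by (metis card.empty ex_in_conv nat.distinct(1))
      then have "t \<in> A" "\<And>s. s \<in> S \<Longrightarrow> dist s t \<le> \<delta>"
        using False Suc.prems by (auto simp: not_less)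
      then show ?thesis
        using Suc.prems by (intro dd_error_same_ball[OF M _ F]) auto
    qed
  qed
  then have "dd smul ?g S \<in> scaled_submodule smul (\<delta> ^ (Suc k - card S)) M"
    using S by simp
  \<comment> \<open>The bound \<open>\<delta> \<le> 1\<close> enters here: the power of \<delta>
    served the induction and is now discarded.\<close>
  moreover have "\<delta> ^ (Suc k - card S) \<le> 1"
    using \<delta> by (simp add: power_le_one)
  ultimately show ?thesis
    using scaled_submodule_le_1[OF M] by blast
qed

end

section \<open>Several variables\<close>

text \<open>The tensor product of the one-variable divided differences. A function \<open>c\<close>
  chooses one node per coordinate, that is, a point of the grid spanned by \<open>X\<close>.\<close>

definition mdd ::
    "('k::field \<Rightarrow> 'e::ab_group_add \<Rightarrow> 'e) \<Rightarrow> ('k ^ 'n::finite \<Rightarrow> 'e) \<Rightarrow> ('n \<Rightarrow> 'k set) \<Rightarrow> 'e" where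
  "mdd smul f X = (\<Sum>c\<in>PiE UNIV X.
     smul (\<Prod>i\<in>UNIV. \<Prod>t\<in>X i - {c i}. 1 / (c i - t)) (f (vec_lambda c)))"

text \<open>Divided differences are taken in all coordinates except \<open>i\<close>, which is left
  free. The functions \<open>c\<close> carry no value at \<open>i\<close> until \<open>t\<close> is
  inserted, and the set \<open>X i\<close> does not enter.\<close>

definition slice ::
    "('k::field \<Rightarrow> 'e::ab_group_add \<Rightarrow> 'e) \<Rightarrow> ('k ^ 'n::finite \<Rightarrow> 'e) \<Rightarrow> ('n \<Rightarrow> 'k set) \<Rightarrow> 'n \<Rightarrow> 'k \<Rightarrow> 'e" where
  "slice smul f X i t = (\<Sum>c\<in>PiE (UNIV - {i}) X.
     smul (\<Prod>j\<in>UNIV - {i}. \<Prod>t\<in>X j - {c j}. 1 / (c j - t)) (f (vec_lambda (c(i := t)))))"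

definition interpolate_coord ::
    "('k::field \<Rightarrow> 'e::ab_group_add \<Rightarrow> 'e) \<Rightarrow> ('k \<Rightarrow> 'k set) \<Rightarrow> 'n \<Rightarrow> ('k ^ 'n::finite \<Rightarrow> 'e) \<Rightarrow> 'k ^ 'n \<Rightarrow> 'e" where
  "interpolate_coord smul C i f x =
     lagrange smul (C (x $ i)) (\<lambda>t. f (\<chi> j. if j = i then t else x $ j)) (x $ i)"

text \<open>A closed form for the interpolations in the coordinates of \<open>J\<close>, from which
  polynomiality can be read off. The iterated form, which suits the error estimate, is recovered in
  \<open>interpolate_insert\<close>.\<close>

definition interpolate ::
    "('k::field \<Rightarrow> 'e::ab_group_add \<Rightarrow> 'e) \<Rightarrow> ('n \<Rightarrow> 'k \<Rightarrow> 'k set) \<Rightarrow> 'n set \<Rightarrow> ('k ^ 'n::finite \<Rightarrow> 'e) \<Rightarrow> 'k ^ 'n \<Rightarrow> 'e" where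
  "interpolate smul C J f x = (\<Sum>c\<in>PiE J (\<lambda>i. C i (x $ i)).
     smul (\<Prod>i\<in>J. lagrange_basis (C i (x $ i)) (c i) (x $ i)) (f (\<chi> j. if j \<in> J then c j else x $ j)))"

text \<open>A set of \<open>m\<close> nodes belongs to order \<open>m - 1\<close>. So the nonempty
  sets with at most \<open>Suc (a i)\<close> nodes stand for all orders up to
  \<open>a i\<close>.\<close>

definition admissible :: "('n \<Rightarrow> 'k set) \<Rightarrow> ('n \<Rightarrow> nat) \<Rightarrow> ('n \<Rightarrow> 'k set) \<Rightarrow> bool" where
  "admissible A a X \<longleftrightarrow> (\<forall>i. finite (X i) \<and> X i \<noteq> {} \<and> X i \<subseteq> A i \<and> card (X i) \<le> Suc (a i))"

definition dd_small ::
    "('k::field \<Rightarrow> 'e::ab_group_add \<Rightarrow> 'e) \<Rightarrow> ('n \<Rightarrow> 'k set) \<Rightarrow> ('n \<Rightarrow> nat) \<Rightarrow> 'e set \<Rightarrow> ('k ^ 'n::finite \<Rightarrow> 'e) \<Rightarrow> bool" where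
  "dd_small smul A a M f \<longleftrightarrow> (\<forall>X. admissible A a X \<longrightarrow> mdd smul f X \<in> M)"

lemma sum_PiE_insert:
  assumes "i \<notin> I"
  shows "(\<Sum>c\<in>PiE (insert i I) X. H c) = (\<Sum>t\<in>X i. \<Sum>c\<in>PiE I X. H (c(i := t)))"
  unfolding PiE_insert_eq sum.reindex[OF inj_combinator[OF assms]] sum.cartesian_product
  by (simp add: case_prod_unfold)

lemma slice_fun_upd: "slice smul f (X(i := S)) i = slice smul f X i"
proof -
  have "PiE (UNIV - {i}) (X(i := S)) = PiE (UNIV - {i}) X"
    by (intro PiE_cong) auto
  then show ?thesis
    by (auto simp: slice_def fun_eq_iff intro!: sum.cong arg_cong2[where f = smul] prod.cong)
qed

context vector_space
begin

lemma mdd_eq_dd_slice: "mdd scale f X = dd scale (slice scale f X i) (X i)"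
proof -
  have U: "UNIV = insert i (UNIV - {i})"
    by auto
  let ?H = "\<lambda>c. scale (\<Prod>j\<in>UNIV. \<Prod>t\<in>X j - {c j}. 1 / (c j - t)) (f (vec_lambda c))"
  have *: "?H (c(i := t)) = scale (\<Prod>u\<in>X i - {t}. 1 / (t - u))
      (scale (\<Prod>j\<in>UNIV - {i}. \<Prod>t\<in>X j - {c j}. 1 / (c j - t)) (f (vec_lambda (c(i := t)))))" for c t
    by (subst prod.remove[of UNIV i]) (auto intro!: arg_cong2[where f = scale] prod.cong)
  have "mdd scale f X = (\<Sum>c\<in>PiE (insert i (UNIV - {i})) X. ?H c)"
    unfolding mdd_def using U by presburger
  also have "\<dots> = (\<Sum>t\<in>X i. \<Sum>c\<in>PiE (UNIV - {i}) X. ?H (c(i := t)))"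
    by (rule sum_PiE_insert) simp
  also have "\<dots> = dd scale (slice scale f X i) (X i)"
    unfolding dd_def slice_def scale_sum_right * ..
  finally show ?thesis .
qed

lemma mdd_fun_upd: "mdd scale f (X(i := S)) = dd scale (slice scale f X i) S"
  using mdd_eq_dd_slice[of f "X(i := S)" i] by (simp add: slice_fun_upd)

lemma mdd_cong:
  assumes "\<And>c. (\<And>i. c i \<in> X i) \<Longrightarrow> f (vec_lambda c) = g (vec_lambda c)"
  shows "mdd scale f X = mdd scale g X"
  unfolding mdd_def using assms by (intro sum.cong) (auto simp: PiE_iff)

lemma mdd_add: "mdd scale (\<lambda>x. f x + g x) X = mdd scale f X + mdd scale g X"
  by (simp add: mdd_def scale_right_distrib sum.distrib)

lemma mdd_diff: "mdd scale (\<lambda>x. f x - g x) X = mdd scale f X - mdd scale g X"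
  by (simp add: mdd_def scale_right_diff_distrib sum_subtractf)

lemma mdd_sum: "mdd scale (\<lambda>x. \<Sum>b\<in>B. f b x) X = (\<Sum>b\<in>B. mdd scale (f b) X)"
  unfolding mdd_def scale_sum_right by (rule sum.swap)

text \<open>Distributivity: the sum over the grid of a product of one-variable functions
  factorizes.\<close>

lemma mdd_product:
  assumes "\<And>i. finite (X i)"
  shows "mdd scale (\<lambda>x. scale (\<Prod>i\<in>UNIV. \<phi> i (x $ i)) e) X = scale (\<Prod>i\<in>UNIV. dd (*) (\<phi> i) (X i)) e"
proof -
  have "(\<Prod>i\<in>UNIV. dd (*) (\<phi> i) (X i)) =
      (\<Sum>c\<in>PiE UNIV X. \<Prod>i\<in>UNIV. (\<Prod>t\<in>X i - {c i}. 1 / (c i - t)) * \<phi> i (c i))"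
    unfolding dd_def by (rule prod_sum_PiE) (use assms in auto)
  then show ?thesis
    by (simp add: mdd_def scale_sum_left prod.distrib)
qed

lemma slice_diff:
  "slice scale (\<lambda>x. f x - g x) X i = (\<lambda>t. slice scale f X i t - slice scale g X i t)"
  by (simp add: slice_def scale_right_diff_distrib sum_subtractf fun_eq_iff)

text \<open>Interpolation in coordinate \<open>i\<close> and divided differences in the other
  coordinates are linear operations on different variables, so they commute. This reduces the error
  in several variables to \<open>dd_error\<close>.\<close>

lemma slice_interpolate_coord:
  "slice scale (interpolate_coord scale C i f) X i t = lagrange scale (C t) (slice scale f X i) t"
proof -
  have "(\<chi> j. if j = i then s else vec_lambda (c(i := t)) $ j) = vec_lambda (c(i := s))" for c s
    by (auto simp: vec_eq_iff)
  then show ?thesis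
    unfolding slice_def interpolate_coord_def lagrange_def scale_sum_right scale_scale
    by (subst sum.swap) (simp add: mult.commute)
qed

lemma interpolate_coord_diff:
  "interpolate_coord scale C i (\<lambda>x. f x - g x) x = interpolate_coord scale C i f x - interpolate_coord scale C i g x"
  by (simp add: interpolate_coord_def lagrange_def scale_right_diff_distrib sum_subtractf)

lemma interpolate_empty: "interpolate scale C {} f = f"
  by (simp add: interpolate_def fun_eq_iff)

text \<open>Since \<open>i\<close> is not in \<open>J\<close>, replacing the \<open>i\<close>-th
  coordinate of \<open>x\<close> changes neither the nodes nor the basis values belonging to
  \<open>J\<close>.\<close>

lemma interpolate_insert:
  assumes "i \<notin> J"
  shows "interpolate scale C (insert i J) f = interpolate_coord scale (C i) i (interpolate scale C J f)"
proof
  fix x :: "'a ^ 'c"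
  let ?y = "\<lambda>t. \<chi> j. if j = i then t else x $ j"
  let ?X = "\<lambda>i. C i (x $ i)"
  let ?L = "\<lambda>i c. lagrange_basis (C i (x $ i)) c (x $ i)"
  have J: "finite J"
    by simp
  have *: "interpolate scale C J f (?y t) = (\<Sum>c\<in>PiE J ?X. scale (\<Prod>j\<in>J. ?L j (c j))
      (f (\<chi> j. if j \<in> insert i J then (c(i := t)) j else x $ j)))" for t
  proof -
    have 1: "PiE J (\<lambda>j. C j (?y t $ j)) = PiE J ?X"
      using assms by (intro PiE_cong) auto
    have 2: "(\<Prod>j\<in>J. lagrange_basis (C j (?y t $ j)) (c j) (?y t $ j)) = (\<Prod>j\<in>J. ?L j (c j))" for c
      using assms by (intro prod.cong) auto
    have 3: "(\<chi> j. if j \<in> J then c j else ?y t $ j) = (\<chi> j. if j \<in> insert i J then (c(i := t)) j else x $ j)" for c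
      using assms by (auto simp: vec_eq_iff)
    show ?thesis
      unfolding interpolate_def 1 2 3 ..
  qed
  have "(\<Prod>j\<in>J. ?L j ((c(i := t)) j)) = (\<Prod>j\<in>J. ?L j (c j))" for c t
    using assms by (intro prod.cong) auto
  then have "interpolate scale C (insert i J) f x = (\<Sum>t\<in>?X i. \<Sum>c\<in>PiE J ?X.
      scale (?L i t * (\<Prod>j\<in>J. ?L j (c j))) (f (\<chi> j. if j \<in> insert i J then (c(i := t)) j else x $ j)))"
    unfolding interpolate_def sum_PiE_insert[OF assms] prod.insert[OF J assms] by simp
  also have "\<dots> = interpolate_coord scale (C i) i (interpolate scale C J f) x"
    unfolding interpolate_coord_def lagrange_def * scale_sum_right scale_scale ..
  finally show "interpolate scale C (insert i J) f x = interpolate_coord scale (C i) i (interpolate scale C J f) x" .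
qed

end

lemma admissible_fun_upd:
  assumes "admissible A a X" "finite S" "S \<noteq> {}" "S \<subseteq> A i" "card S \<le> Suc (a i)"
  shows "admissible A a (X(i := S))"
  using assms by (simp add: admissible_def)

locale grid_interpolation = ultrametric_vector_space smul
  for smul :: "'k::ultrametric_field \<Rightarrow> 'e::ab_group_add \<Rightarrow> 'e" +
  fixes A :: "'n::finite \<Rightarrow> 'k set" and \<delta> :: real and a :: "'n \<Rightarrow> nat" and C :: "'n \<Rightarrow> 'k \<Rightarrow> 'k set"
  assumes coord: "local_interpolation smul (A i) \<delta> (a i) (C i)"
begin

lemma dd_small_interpolate_coord_error:
  assumes M: "unit_ball_submodule smul M"
    and f: "\<And>X S S' t. admissible A a (X(i := S)) \<Longrightarrow> admissible A a (X(i := S')) \<Longrightarrow> t \<in> A i \<Longrightarrow>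
      card S = Suc (a i) \<Longrightarrow> card S' = Suc (a i) \<Longrightarrow>
      (\<And>s. s \<in> S \<union> S' \<Longrightarrow> dist s t \<le> \<delta>) \<Longrightarrow> mdd smul f (X(i := S)) - mdd smul f (X(i := S')) \<in> M"
  shows "dd_small smul A a M (\<lambda>x. f x - interpolate_coord smul (C i) i f x)"
  unfolding dd_small_def
proof (intro allI impI)
  interpret c: local_interpolation smul "A i" \<delta> "a i" "C i"
    by (rule coord)
  fix X assume X: "admissible A a X"
  have "mdd smul (\<lambda>x. f x - interpolate_coord smul (C i) i f x) X =
      dd smul (\<lambda>t. slice smul f X i t - lagrange smul (C i t) (slice smul f X i) t) (X i)"
    by (simp add: mdd_eq_dd_slice[where i = i] slice_diff slice_interpolate_coord)
  moreover have "\<dots> \<in> M"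
  proof (rule c.dd_error[OF M])
    show "finite (X i)" "X i \<subseteq> A i" "card (X i) \<le> Suc (a i)"
      using X by (auto simp: admissible_def)
    fix t S
    assume *: "t \<in> A i" "finite S" "S \<subseteq> A i" "card S = Suc (a i)" "\<And>s. s \<in> S \<Longrightarrow> dist s t \<le> \<delta>"
    have "mdd smul f (X(i := S)) - mdd smul f (X(i := C i t)) \<in> M"
    proof (rule f[OF _ _ *(1) *(4)])
      show "admissible A a (X(i := S))"
        using X * by (intro admissible_fun_upd) auto
      show "admissible A a (X(i := C i t))"
        using X c.finite_nodes[OF *(1)] c.card_nodes[OF *(1)] c.nodes_subset[OF *(1)]
        by (intro admissible_fun_upd) auto
    qed (use * c.card_nodes c.nodes_dist in auto)
    then show "dd smul (slice smul f X i) S - dd smul (slice smul f X i) (C i t) \<in> M"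
      by (simp add: mdd_fun_upd)
  qed
  ultimately show "mdd smul (\<lambda>x. f x - interpolate_coord smul (C i) i f x) X \<in> M"
    by simp
qed

text \<open>If all divided differences of \<open>f\<close> lie in \<open>M\<close>, so do the
  differences that control the interpolation error. The interpolant is \<open>f\<close> minus this
  error, hence small for the same \<open>M\<close>.\<close>

lemma dd_small_interpolate_coord:
  assumes M: "unit_ball_submodule smul M" and f: "dd_small smul A a M f"
  shows "dd_small smul A a M (interpolate_coord smul (C i) i f)"
proof -
  have "dd_small smul A a M (\<lambda>x. f x - interpolate_coord smul (C i) i f x)"
    using submodule_diff[OF M] f unfolding dd_small_def
    by (intro dd_small_interpolate_coord_error[OF M, unfolded dd_small_def]) blast
  then have "dd_small smul A a M (\<lambda>x. f x - (f x - interpolate_coord smul (C i) i f x))"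
    using f submodule_diff[OF M] unfolding dd_small_def mdd_diff by blast
  then show ?thesis
    by simp
qed

text \<open>With P for interpolation, the induction rests on f - P_i P_J f = (f - P_i f) + P_i (f -
  P_J f). The first term is a one-coordinate error of the original \<open>f\<close>; the second is
  the interpolant of a function that is already small.\<close>

lemma dd_small_interpolate_error:
  assumes M: "unit_ball_submodule smul M"
    and f: "\<And>X i S S' t. admissible A a (X(i := S)) \<Longrightarrow> admissible A a (X(i := S')) \<Longrightarrow> t \<in> A i \<Longrightarrow>
      card S = Suc (a i) \<Longrightarrow> card S' = Suc (a i) \<Longrightarrow>
      (\<And>s. s \<in> S \<union> S' \<Longrightarrow> dist s t \<le> \<delta>) \<Longrightarrow> mdd smul f (X(i := S)) - mdd smul f (X(i := S')) \<in> M"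
  shows "dd_small smul A a M (\<lambda>x. f x - interpolate smul C J f x)"
proof -
  have "finite J"
    by simp
  then show ?thesis
  proof (induction J rule: finite_induct)
    case empty
    have "mdd smul (\<lambda>_. 0) X = 0" for X :: "'n \<Rightarrow> 'k set"
      by (simp add: mdd_def)
    then show ?case
      using M by (simp add: interpolate_empty dd_small_def unit_ball_submodule_def)
  next
    case (insert i J)
    have "dd_small smul A a M (\<lambda>x. f x - interpolate_coord smul (C i) i f x)"
      by (rule dd_small_interpolate_coord_error[OF M f])
    moreover have "dd_small smul A a M (interpolate_coord smul (C i) i (\<lambda>x. f x - interpolate smul C J f x))"
      by (rule dd_small_interpolate_coord[OF M insert.IH])
    ultimately have "dd_small smul A a M (\<lambda>x. f x - interpolate_coord smul (C i) i f x +
        interpolate_coord smul (C i) i (\<lambda>x. f x - interpolate smul C J f x) x)"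
      using M unfolding dd_small_def mdd_add unit_ball_submodule_def by blast
    then show ?case
      by (simp add: interpolate_insert[OF insert.hyps(2)] interpolate_coord_diff)
  qed
qed

end

section \<open>Continuous extension of divided differences\<close>

lemma tendsto_dist_0_iff: "(f \<longlongrightarrow> l) F \<longleftrightarrow> ((\<lambda>x. dist (f x) l) \<longlongrightarrow> 0) F"
  by (simp add: tendsto_iff)

lemma tendsto_dist_le:
  assumes "(h \<longlongrightarrow> 0) F" "\<And>x. dist (f x) l \<le> h x"
  shows "(f \<longlongrightarrow> l) F"
  unfolding tendsto_dist_0_iff[of f]
  by (rule tendsto_sandwich[OF _ _ tendsto_const assms(1)]) (simp_all add: assms(2))

instance ultrametric_field \<subseteq> topological_ab_group_add
proof
  fix a b :: 'a
  let ?F = "nhds a \<times>\<^sub>F nhds b"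
  have lim: "((\<lambda>x. dist (fst x) a) \<longlongrightarrow> 0) ?F" "((\<lambda>x. dist (snd x) b) \<longlongrightarrow> 0) ?F"
    using filterlim_fst[of "nhds a" "nhds b"] filterlim_snd[of "nhds b" "nhds a"]
    by (simp_all add: tendsto_dist_0_iff[symmetric])
  have "((\<lambda>x. max (dist (fst x) a) (dist (snd x) b)) \<longlongrightarrow> 0) ?F"
    using tendsto_max[OF lim] by simp
  moreover have "dist (fst x + snd x) (a + b) \<le> max (dist (fst x) a) (dist (snd x) b)" for x :: "'a \<times> 'a"
    using absval_add_le_max[of "fst x - a" "snd x - b"] by (simp add: dist_absval algebra_simps)
  ultimately show "((\<lambda>x. fst x + snd x) \<longlongrightarrow> a + b) ?F"
    by (rule tendsto_dist_le)
next
  fix a :: 'a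
  have "dist (- x) (- a) = dist x a" for x
    by (metis absval_minus diff_minus_eq_add dist_absval minus_diff_eq uminus_add_conv_diff)
  then show "(uminus \<longlongrightarrow> - a) (nhds a)"
    using tendsto_dist_0_iff[of "\<lambda>x. x" a "nhds a"] tendsto_dist_0_iff[of uminus "- a" "nhds a"]
    by (simp add: filterlim_ident)
qed

instance ultrametric_field \<subseteq> topological_comm_monoid_mult
proof
  fix a b :: 'a
  let ?F = "nhds a \<times>\<^sub>F nhds b"
  let ?h = "\<lambda>x. dist (fst x) a * dist (snd x) b + absval a * dist (snd x) b + dist (fst x) a * absval b"
  have lim: "((\<lambda>x. dist (fst x) a) \<longlongrightarrow> 0) ?F" "((\<lambda>x. dist (snd x) b) \<longlongrightarrow> 0) ?F"
    using filterlim_fst[of "nhds a" "nhds b"] filterlim_snd[of "nhds b" "nhds a"]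
    by (simp_all add: tendsto_dist_0_iff[symmetric])
  have "(?h \<longlongrightarrow> 0 * 0 + absval a * 0 + 0 * absval b) ?F"
    by (intro tendsto_intros lim)
  then have "(?h \<longlongrightarrow> 0) ?F"
    by simp
  moreover have "dist (fst x * snd x) (a * b) \<le> ?h x" for x :: "'a \<times> 'a"
  proof -
    let ?u = "fst x - a" and ?v = "snd x - b"
    have "fst x * snd x - a * b = ?u * ?v + a * ?v + ?u * b"
      by (simp add: algebra_simps)
    moreover have "absval (?u * ?v + a * ?v + ?u * b) \<le> absval (?u * ?v) + absval (a * ?v) + absval (?u * b)"
      using absval_add_le_max[of "?u * ?v + a * ?v" "?u * b"] absval_add_le_max[of "?u * ?v" "a * ?v"]
        absval_nonneg[of "?u * ?v"] absval_nonneg[of "a * ?v"] absval_nonneg[of "?u * b"] by linarith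
    ultimately show ?thesis
      by (simp add: dist_absval absval_mult)
  qed
  ultimately show "((\<lambda>x. fst x * snd x) \<longlongrightarrow> a * b) ?F"
    by (rule tendsto_dist_le)
qed

section \<open>Continuous extension in one variable\<close>

lemma continuous_on_locally_constant:
  fixes f :: "'a::metric_space \<Rightarrow> 'b::topological_space"
  assumes "0 < \<delta>" "\<And>s t. s \<in> A \<Longrightarrow> t \<in> A \<Longrightarrow> dist s t < \<delta> \<Longrightarrow> f s = f t"
  shows "continuous_on A f"
  unfolding continuous_on_def
proof
  fix t assume "t \<in> A"
  have "\<forall>\<^sub>F s in at t within A. f s = f t"
    unfolding eventually_at using assms \<open>t \<in> A\<close> by blast
  then show "(f \<longlongrightarrow> f t) (at t within A)"
    by (rule tendsto_eventually)
qed

text \<open>The index set \<open>I\<close> is an arbitrary finite set, not an initial segment, so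
  that an induction can delete any node. Only the coordinates in \<open>I\<close> of the total
  function \<open>x\<close> matter.\<close>

definition dd_extendable :: "'k::ultrametric_field set \<Rightarrow> ('k \<Rightarrow> 'k) \<Rightarrow> bool" where
  "dd_extendable A \<phi> \<longleftrightarrow> (\<forall>I::nat set. finite I \<longrightarrow>
     (\<exists>G. continuous_on {x. \<forall>m\<in>I. x m \<in> A} G \<and>
        (\<forall>x. (\<forall>m\<in>I. x m \<in> A) \<longrightarrow> inj_on x I \<longrightarrow> G x = dd (*) \<phi> (x ` I))))"

lemma dd_extendableE:
  fixes I :: "nat set"
  assumes "dd_extendable A \<phi>" "finite I"
  obtains G where "continuous_on {x. \<forall>m\<in>I. x m \<in> A} G"
    "\<And>x. x \<in> {x. \<forall>m\<in>I. x m \<in> A} \<Longrightarrow> inj_on x I \<Longrightarrow> G x = dd (*) \<phi> (x ` I)"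
proof -
  have "\<exists>G. continuous_on {x. \<forall>m\<in>I. x m \<in> A} G \<and>
      (\<forall>x. (\<forall>m\<in>I. x m \<in> A) \<longrightarrow> inj_on x I \<longrightarrow> G x = dd (*) \<phi> (x ` I))"
    using assms(1)[unfolded dd_extendable_def, rule_format, OF assms(2)] .
  then show ?thesis
    using that by (elim exE conjE) simp
qed

text \<open>The closed ball of radius \<delta> is also open when \<delta> is positive. Cutting off
  the inverse there therefore leaves a continuous function, which still inverts \<open>t\<close>
  outside the ball.\<close>

definition trunc_inverse :: "real \<Rightarrow> 'k::ultrametric_field \<Rightarrow> 'k" where
  "trunc_inverse \<delta> t = (if absval t \<le> \<delta> then 0 else 1 / t)"

definition ball_indicator :: "real \<Rightarrow> 'k::ultrametric_field \<Rightarrow> 'k" where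
  "ball_indicator \<delta> t = (if absval t \<le> \<delta> then 1 else 0)"

lemma absval_eq_of_dist_lt:
  fixes s t :: "'k::ultrametric_field"
  assumes "dist s t < \<delta>"
  shows "absval s \<le> \<delta> \<longleftrightarrow> absval t \<le> \<delta>"
  using assms absval_add_le_max[of "s - t" t] absval_add_le_max[of "t - s" s]
  by (auto simp: dist_absval[symmetric] dist_commute)

lemma continuous_on_ball_indicator:
  assumes "0 < \<delta>"
  shows "continuous_on S (ball_indicator \<delta>)"
  by (rule continuous_on_locally_constant[OF assms]) (simp add: ball_indicator_def absval_eq_of_dist_lt)

text \<open>Two points closer than \<delta> are both inside the ball or both outside. Outside, both
  absolute values exceed \<delta>, which gives the Lipschitz constant
  \<open>1 / \<delta>\<^sup>2\<close>.\<close>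

lemma continuous_on_trunc_inverse:
  assumes "0 < \<delta>"
  shows "continuous_on S (trunc_inverse \<delta> :: 'k::ultrametric_field \<Rightarrow> 'k)"
proof -
  have *: "dist (trunc_inverse \<delta> s) (trunc_inverse \<delta> t :: 'k) \<le> dist s t / \<delta>\<^sup>2" if "dist s t < \<delta>" for s t :: 'k
  proof (cases "absval s \<le> \<delta>")
    case True
    then show ?thesis
      using absval_eq_of_dist_lt[OF that] by (simp add: trunc_inverse_def)
  next
    case False
    then have gt: "absval s > \<delta>" "absval t > \<delta>"
      using absval_eq_of_dist_lt[OF that] by auto
    then have nz: "s \<noteq> 0" "t \<noteq> 0"
      using assms by auto
    then have "1 / s - 1 / t = (t - s) / (s * t)"
      by (simp add: field_simps)
    then have "dist (1 / s) (1 / t) = dist s t / (absval s * absval t)"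
      by (simp add: dist_absval absval_divide absval_mult) (metis dist_absval dist_commute)
    also have "\<dots> \<le> dist s t / \<delta>\<^sup>2"
      unfolding power2_eq_square using gt assms by (intro divide_left_mono mult_mono mult_pos_pos) auto
    finally show ?thesis
      using gt by (simp add: trunc_inverse_def)
  qed
  show ?thesis
    unfolding continuous_on_iff
  proof (intro ballI allI impI)
    fix t :: 'k and e :: real assume "0 < e"
    have "dist (trunc_inverse \<delta> s) (trunc_inverse \<delta> t) < e" if "dist s t < min \<delta> (e * \<delta>\<^sup>2)" for s
      using *[of s t] that assms by (simp add: divide_less_eq order_le_less_trans)
    then show "\<exists>d>0. \<forall>s\<in>S. dist s t < d \<longrightarrow> dist (trunc_inverse \<delta> s) (trunc_inverse \<delta> t) < e"
      using \<open>0 < e\<close> assms by (intro exI[of _ "min \<delta> (e * \<delta>\<^sup>2)"]) auto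
  qed
qed

text \<open>Induction on the number of nodes. The recursion is harmless for two nodes at distance
  more than \<delta>, and the divided difference of a constant vanishes if all nodes are near each
  other. The difficulty is to choose between these cases in a way that is continuous in the
  nodes.\<close>

lemma dd_extendable_locally_constant:
  fixes \<phi> :: "'k::ultrametric_field \<Rightarrow> 'k"
  assumes \<delta>: "0 < \<delta>" and \<phi>: "\<And>s t. s \<in> A \<Longrightarrow> t \<in> A \<Longrightarrow> dist s t \<le> \<delta> \<Longrightarrow> \<phi> s = \<phi> t"
  shows "dd_extendable A \<phi>"
  unfolding dd_extendable_def
proof (intro allI impI)
  fix I :: "nat set" assume "finite I"
  then show "\<exists>G. continuous_on {x. \<forall>m\<in>I. x m \<in> A} G \<and>
        (\<forall>x. (\<forall>m\<in>I. x m \<in> A) \<longrightarrow> inj_on x I \<longrightarrow> G x = dd (*) \<phi> (x ` I))"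
  proof (induction "card I" arbitrary: I rule: less_induct)
    case less
    let ?D = "\<lambda>I. {x. \<forall>m\<in>I. x m \<in> A}"
    have coord: "continuous_on S (\<lambda>x. x m)" for S :: "(nat \<Rightarrow> 'k) set" and m
      by (rule continuous_on_subset[OF continuous_on_product_coordinates]) simp
    consider "I = {}" | i where "I = {i}" | "card I \<ge> 2"
      using less.prems
      by (metis One_nat_def Suc_1 card_1_singletonE card_eq_0_iff less_2_cases_iff not_less)
    then show ?case
    proof cases
      case 1
      then show ?thesis
        by (intro exI[of _ "\<lambda>_. 0"]) auto
    next
      case 2
      have "continuous_on A \<phi>"
        using \<delta> by (rule continuous_on_locally_constant) (use \<phi> in auto)
      then have "continuous_on (?D {i}) (\<lambda>x. \<phi> (x i))"
        by (rule continuous_on_compose2[OF _ coord]) auto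
      then show ?thesis
        unfolding 2 by (intro exI[of _ "\<lambda>x. \<phi> (x i)"]) (simp add: dd_def)
    next
      case 3
      have "\<forall>l\<in>I. \<exists>G. continuous_on (?D (I - {l})) G \<and>
          (\<forall>x. (\<forall>m\<in>I - {l}. x m \<in> A) \<longrightarrow> inj_on x (I - {l}) \<longrightarrow> G x = dd (*) \<phi> (x ` (I - {l})))"
      proof
        fix l assume "l \<in> I"
        then have "card (I - {l}) < card I"
          using less.prems by (rule card_Diff1_less[rotated])
        then show "\<exists>G. continuous_on (?D (I - {l})) G \<and>
          (\<forall>x. (\<forall>m\<in>I - {l}. x m \<in> A) \<longrightarrow> inj_on x (I - {l}) \<longrightarrow> G x = dd (*) \<phi> (x ` (I - {l})))"
          using less.prems by (intro less.hyps) auto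
      qed
      from bchoice[OF this] obtain G where
        G: "\<And>l. l \<in> I \<Longrightarrow> continuous_on (?D (I - {l})) (G l)"
          "\<And>l x. l \<in> I \<Longrightarrow> x \<in> ?D (I - {l}) \<Longrightarrow> inj_on x (I - {l}) \<Longrightarrow> G l x = dd (*) \<phi> (x ` (I - {l}))"
        by blast
      have G_cont: "continuous_on (?D I) (G l)" if "l \<in> I" for l
        using G(1)[OF that] by (rule continuous_on_subset) auto
      obtain i where i: "i \<in> I"
        using 3 by fastforce
      let ?\<kappa> = "\<lambda>m x. ball_indicator \<delta> (x i - x m)"
      have sub_cont: "continuous_on S (\<lambda>x. x i - x m)" for S :: "(nat \<Rightarrow> 'k) set" and m
        by (intro continuous_on_diff coord)
      have \<kappa>_cont: "continuous_on S (?\<kappa> m)" for S :: "(nat \<Rightarrow> 'k) set" and m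
        by (rule continuous_on_compose2[OF continuous_on_ball_indicator[OF \<delta>, of UNIV] sub_cont]) simp
      have \<theta>_cont: "continuous_on S (\<lambda>x. trunc_inverse \<delta> (x i - x m))" for S :: "(nat \<Rightarrow> 'k) set" and m
        by (rule continuous_on_compose2[OF continuous_on_trunc_inverse[OF \<delta>, of UNIV] sub_cont]) simp
      \<comment> \<open>The recursion is kept in multiplied form, so that it can be multiplied by
        the truncated inverse whether or not \<open>x l\<close> is close to
        \<open>x i\<close>.\<close>
      have step: "(x i - x l) * dd (*) \<phi> (x ` I) = G l x - G i x"
        if x: "x \<in> ?D I" "inj_on x I" and l: "l \<in> I" "l \<noteq> i" for x l
      proof -
        define I' where "I' = I - {i, l}"
        have I: "I = insert i (insert l I')" "i \<notin> insert l I'" "l \<notin> I'" "finite I'"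
          using i l less.prems by (auto simp: I'_def)
        have G': "G l x = dd (*) \<phi> (x ` (I - {l}))" "G i x = dd (*) \<phi> (x ` (I - {i}))"
          using x l i by (auto intro!: G(2) intro: inj_on_subset)
        have "I - {l} = insert i I'" "I - {i} = insert l I'"
          using I l by auto
        moreover have "x i \<notin> x ` I'" "x l \<notin> x ` I'" "x i \<noteq> x l"
          using x(2) I by auto
        ultimately show ?thesis
          using vector_space.dd_exchange[OF vector_space_mult, of "x ` I'" "x i" "x l" \<phi>] I(4)
          unfolding G' by (simp add: I(1))
      qed
      (* trunc_inverse u * u + ball_indicator u = 1: where x l is far from x i, the divided difference
         is expressed by those with one node less; if all nodes are near x i, it vanishes. *)
      have "\<exists>H. continuous_on (?D I) H \<and> (\<forall>x\<in>?D I. inj_on x I \<longrightarrow>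
          dd (*) \<phi> (x ` I) = H x + (\<Prod>m\<in>J. ?\<kappa> m x) * dd (*) \<phi> (x ` I))"
        if "finite J" "J \<subseteq> I - {i}" for J
        using that
      proof (induction J rule: finite_induct)
        case empty
        show ?case
          by (intro exI[of _ "\<lambda>_. 0"]) auto
      next
        case (insert l J)
        then obtain H where H: "continuous_on (?D I) H"
          "\<And>x. x \<in> ?D I \<Longrightarrow> inj_on x I \<Longrightarrow> dd (*) \<phi> (x ` I) = H x + (\<Prod>m\<in>J. ?\<kappa> m x) * dd (*) \<phi> (x ` I)"
          by auto
        \<comment> \<open>The added summand is the part of the remaining product on which
          \<open>x l\<close> is far from \<open>x i\<close>. What is left acquires the indicator for
          \<open>l\<close>.\<close>
        let ?H = "\<lambda>x. H x + (\<Prod>m\<in>J. ?\<kappa> m x) * (trunc_inverse \<delta> (x i - x l) * (G l x - G i x))"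
        have "continuous_on (?D I) (\<lambda>x. \<Prod>m\<in>J. ?\<kappa> m x)"
          by (intro continuous_on_prod' \<kappa>_cont)
        then have "continuous_on (?D I) ?H"
          using insert.prems i by (intro continuous_on_add continuous_on_mult' continuous_on_diff H \<kappa>_cont \<theta>_cont G_cont) auto
        moreover have "dd (*) \<phi> (x ` I) = ?H x + (\<Prod>m\<in>insert l J. ?\<kappa> m x) * dd (*) \<phi> (x ` I)"
          if x: "x \<in> ?D I" "inj_on x I" for x
        proof -
          let ?d = "dd (*) \<phi> (x ` I)" and ?p = "\<Prod>m\<in>J. ?\<kappa> m x"
          have *: "G l x - G i x = (x i - x l) * ?d"
            using step[OF x, of l] insert.prems by auto
          have "trunc_inverse \<delta> u * u + ball_indicator \<delta> u = 1" for u :: 'k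
            using \<delta> by (auto simp: trunc_inverse_def ball_indicator_def)
          then have "?p * ?d = ?p * ((trunc_inverse \<delta> (x i - x l) * (x i - x l) + ?\<kappa> l x) * ?d)"
            by simp
          also have "\<dots> = ?p * (trunc_inverse \<delta> (x i - x l) * ((x i - x l) * ?d)) + ?\<kappa> l x * ?p * ?d"
            by (simp only: distrib_left distrib_right mult.assoc mult.left_commute)
          finally have "?p * ?d = ?p * (trunc_inverse \<delta> (x i - x l) * ((x i - x l) * ?d)) + ?\<kappa> l x * ?p * ?d" .
          then show ?thesis
            unfolding * prod.insert[OF insert.hyps] using H(2)[OF x] by (simp add: add.assoc)
        qed
        ultimately show ?case
          by blast
      qed
      from this[of "I - {i}"] less.prems obtain H where H: "continuous_on (?D I) H"
        "\<And>x. x \<in> ?D I \<Longrightarrow> inj_on x I \<Longrightarrow>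
          dd (*) \<phi> (x ` I) = H x + (\<Prod>m\<in>I - {i}. ?\<kappa> m x) * dd (*) \<phi> (x ` I)"
        by auto
      have zero: "(\<Prod>m\<in>I - {i}. ?\<kappa> m x) * dd (*) \<phi> (x ` I) = 0" if x: "x \<in> ?D I" "inj_on x I" for x
      proof (cases "\<forall>m\<in>I. dist (x i) (x m) \<le> \<delta>")
        case True
        then have "dd (*) \<phi> (x ` I) = dd (*) (\<lambda>_. \<phi> (x i)) (x ` I)"
          using x i \<phi> by (intro dd_cong) (auto, metis)
        also have "\<dots> = 0"
          using 3 less.prems by (intro vector_space.dd_const[OF vector_space_mult]) (auto simp: card_image[OF x(2)])
        finally show ?thesis
          by simp
      next
        case False
        then obtain m where m: "m \<in> I" "\<not> dist (x i) (x m) \<le> \<delta>"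
          by blast
        then have "m \<in> I - {i}" "?\<kappa> m x = 0"
          using \<delta> by (auto simp: ball_indicator_def dist_absval[symmetric])
        then have "\<exists>m\<in>I - {i}. ?\<kappa> m x = 0"
          by blast
        then have "(\<Prod>m\<in>I - {i}. ?\<kappa> m x) = 0"
          using less.prems by (intro prod_zero) auto
        then show ?thesis
          by simp
      qed
      have "H x = dd (*) \<phi> (x ` I)" if x: "x \<in> ?D I" "inj_on x I" for x
        using H(2)[OF x] unfolding zero[OF x] by simp
      then show ?thesis
        using H(1) by (intro exI[of _ H]) auto
    qed
  qed
qed

text \<open>By the Leibniz rule \<open>dd_mult_ident\<close>, an extension is given by the extension
  for one node fewer plus \<open>x i\<close> times the extension for all nodes.\<close>

lemma dd_extendable_mult_ident:
  fixes \<phi> :: "'k::ultrametric_field \<Rightarrow> 'k"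
  assumes "dd_extendable A \<phi>"
  shows "dd_extendable A (\<lambda>t. t * \<phi> t)"
  unfolding dd_extendable_def
proof (intro allI impI)
  fix I :: "nat set" assume I: "finite I"
  let ?D = "\<lambda>I. {x. \<forall>m\<in>I. x m \<in> A}"
  show "\<exists>G. continuous_on (?D I) G \<and>
      (\<forall>x. (\<forall>m\<in>I. x m \<in> A) \<longrightarrow> inj_on x I \<longrightarrow> G x = dd (*) (\<lambda>t. t * \<phi> t) (x ` I))"
  proof (cases "I = {}")
    case True
    then show ?thesis
      by (intro exI[of _ "\<lambda>_. 0"]) auto
  next
    case False
    then obtain i I' where i: "I = insert i I'" "i \<notin> I'"
      by (metis ex_in_conv mk_disjoint_insert)
    have fin: "finite I'"
      using I i by simp
    obtain G where G: "continuous_on (?D I) G"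
        "\<And>x. x \<in> ?D I \<Longrightarrow> inj_on x I \<Longrightarrow> G x = dd (*) \<phi> (x ` I)"
      using dd_extendableE[OF assms I] by blast
    obtain G' where G': "continuous_on (?D I') G'"
        "\<And>x. x \<in> ?D I' \<Longrightarrow> inj_on x I' \<Longrightarrow> G' x = dd (*) \<phi> (x ` I')"
      using dd_extendableE[OF assms fin] by blast
    have "continuous_on (?D I) (\<lambda>x. x i)"
      by (rule continuous_on_subset[OF continuous_on_product_coordinates]) simp
    moreover have "continuous_on (?D I) G'"
      using G'(1) by (rule continuous_on_subset) (use i in auto)
    ultimately have "continuous_on (?D I) (\<lambda>x. G' x + x i * G x)"
      using G(1) by (intro continuous_on_add continuous_on_mult')
    moreover have "G' x + x i * G x = dd (*) (\<lambda>t. t * \<phi> t) (x ` I)" if "x \<in> ?D I" "inj_on x I" for x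
    proof -
      have "x i \<notin> x ` I'" "inj_on x I'" "x \<in> ?D I'"
        using that i by auto
      then show ?thesis
        using G(2)[OF that] G'(2)[of x] vector_space.dd_mult_ident[OF vector_space_mult, of "x ` I'" "x i" \<phi>] fin i
        by simp
    qed
    ultimately show ?thesis
      by (intro exI[of _ "\<lambda>x. G' x + x i * G x"]) auto
  qed
qed

lemma dd_extendable_power_mult: "dd_extendable A \<phi> \<Longrightarrow> dd_extendable A (\<lambda>t. t ^ m * \<phi> t)"
  by (induction m) (simp_all add: dd_extendable_mult_ident mult.assoc)

section \<open>Spaces of nodes\<close>

abbreviation factor :: "('k ^ 'n) set \<Rightarrow> 'n \<Rightarrow> 'k set" where
  "factor U i \<equiv> (\<lambda>u. u $ i) ` U"

text \<open>For nonempty \<open>U\<close> the factors in the definition of \<open>cartesian\<close>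
  are determined: they are the projections, because one coordinate of a point can be changed freely.
  For empty \<open>U\<close> both claims are trivial.\<close>

lemma
  fixes U :: "('k::topological_space ^ 'n::finite) set"
  assumes "cartesian U"
  shows mem_cartesian_iff: "x \<in> U \<longleftrightarrow> (\<forall>i. x $ i \<in> factor U i)"
    and cartesian_islimpt: "t \<in> factor U i \<Longrightarrow> t islimpt factor U i"
proof -
  obtain A where A: "\<And>i a. \<not> a isolated_in A i" "U = {x. \<forall>i. x $ i \<in> A i}"
    using assms unfolding cartesian_def by blast
  have factor: "factor U i = A i" if "u \<in> U" for u i
  proof
    show "factor U i \<subseteq> A i"
      using A(2) by auto
    show "A i \<subseteq> factor U i"
    proof
      fix t assume "t \<in> A i"
      then have "(\<chi> j. if j = i then t else u $ j) \<in> U"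
        using that A(2) by auto
      then show "t \<in> factor U i"
        by (rule rev_image_eqI) simp
    qed
  qed
  show "x \<in> U \<longleftrightarrow> (\<forall>i. x $ i \<in> factor U i)"
  proof (cases "U = {}")
    case False
    then obtain u where "u \<in> U"
      by blast
    then show ?thesis
      using factor A(2) by simp
  qed simp
  show "t islimpt factor U i" if t: "t \<in> factor U i"
  proof -
    obtain u where "u \<in> U"
      using t by blast
    then have "\<not> t isolated_in factor U i"
      using factor A(1) by metis
    then show ?thesis
      using t by (simp add: isolated_in_islimpt_iff)
  qed
qed

text \<open>The use made of the absence of isolated points: it supplies interpolation nodes in every
  ball, and distinct nodes near any given ones.\<close>

lemma infinite_ball_factor:
  fixes U :: "('k::metric_space ^ 'n::finite) set"
  assumes "cartesian U" "t \<in> factor U i" "0 < e"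
  shows "infinite (factor U i \<inter> ball t e)"
  using cartesian_islimpt[OF assms(1,2)] assms(3) islimpt_eq_infinite_ball by blast

lemma compact_factor:
  fixes U :: "('k::topological_space ^ 'n::finite) set"
  assumes "compact U"
  shows "compact (factor U i)"
  by (intro compact_continuous_image continuous_on_component continuous_on_id assms)

lemma mem_node_space:
  "x \<in> node_space \<beta> U \<longleftrightarrow> (\<forall>i. x i \<in> extensional {..\<beta> i} \<and> (\<forall>j\<le>\<beta> i. x i j \<in> factor U i))"
  by (auto simp: node_space_def PiE_iff)

lemma mem_distinct_node_space:
  "x \<in> distinct_node_space \<beta> U \<longleftrightarrow> x \<in> node_space \<beta> U \<and> (\<forall>i. inj_on (x i) {..\<beta> i})"
proof -
  have "(\<forall>k\<le>b. \<forall>j<k. y j \<noteq> y k) \<longleftrightarrow> inj_on y {..b}" for y :: "nat \<Rightarrow> 'b" and b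
  proof
    assume *: "\<forall>k\<le>b. \<forall>j<k. y j \<noteq> y k"
    show "inj_on y {..b}"
    proof (rule linorder_inj_onI')
      show "y j \<noteq> y k" if "j < k" "j \<in> {..b}" "k \<in> {..b}" for j k
        using * that by simp
    qed
  next
    assume inj: "inj_on y {..b}"
    show "\<forall>k\<le>b. \<forall>j<k. y j \<noteq> y k"
    proof (intro allI impI)
      fix k j assume "k \<le> b" "j < k"
      then show "y j \<noteq> y k"
        using inj_onD[OF inj, of j k] by auto
    qed
  qed
  then show ?thesis
    by (simp add: distinct_node_space_def)
qed

section \<open>Convergence, compactness and density for tuples of nodes\<close>

lemma tendsto_fun_componentwise:
  fixes f :: "'c \<Rightarrow> 'a \<Rightarrow> 'b::topological_space"
  assumes "\<And>i. ((\<lambda>n. f n i) \<longlongrightarrow> l i) F"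
  shows "(f \<longlongrightarrow> l) F"
proof -
  have "limitin (product_topology (\<lambda>i. euclidean) UNIV) f l F"
    using assms by (simp add: limitin_componentwise)
  then show ?thesis
    by (simp add: euclidean_product_topology)
qed

lemma tendsto_node_space:
  fixes x :: "nat \<Rightarrow> 'n::finite \<Rightarrow> nat \<Rightarrow> 'k::metric_space"
  assumes "l \<in> node_space \<beta> U" "\<And>n. x n \<in> node_space \<beta> U"
    and "\<And>i j. j \<le> \<beta> i \<Longrightarrow> (\<lambda>n. dist (x n i j) (l i j)) \<longlonglongrightarrow> 0"
  shows "x \<longlonglongrightarrow> l"
proof (intro tendsto_fun_componentwise)
  fix i j
  show "(\<lambda>n. x n i j) \<longlonglongrightarrow> l i j"
  proof (cases "j \<le> \<beta> i")
    case True
    then show ?thesis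
      using assms(3) tendsto_dist_0_iff by blast
  next
    case False
    then have "x n i j = l i j" for n
      using assms(1,2) by (simp add: mem_node_space extensional_def)
    then show ?thesis
      by simp
  qed
qed

lemma continuous_on_coordinate2:
  "continuous_on S (\<lambda>x :: 'a \<Rightarrow> 'b \<Rightarrow> 'c::topological_space. x i j)"
proof -
  have "continuous_on UNIV (\<lambda>x :: 'a \<Rightarrow> 'b \<Rightarrow> 'c. x i)" "continuous_on UNIV (\<lambda>y :: 'b \<Rightarrow> 'c. y j)"
    by (rule continuous_on_product_coordinates)+
  then have "continuous_on UNIV (\<lambda>x :: 'a \<Rightarrow> 'b \<Rightarrow> 'c. x i j)"
    using continuous_on_compose2[of UNIV "\<lambda>y :: 'b \<Rightarrow> 'c. y j" UNIV "\<lambda>x. x i"] by simp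
  then show ?thesis
    by (rule continuous_on_subset) simp
qed

lemma compact_node_space:
  fixes U :: "('k::topological_space ^ 'n::finite) set"
  assumes "compact U"
  shows "compact (node_space \<beta> U)"
proof -
  have "compact (PiE {..b} (\<lambda>_. A))" if "compact A" for b :: nat and A :: "'k set"
  proof -
    \<comment> \<open>Coordinates beyond \<open>b\<close> have the fixed value
      \<open>undefined\<close>, so the set is a full product with singleton factors and Tychonoff's
      theorem applies.\<close>
    have "PiE {..b} (\<lambda>_. A) = PiE UNIV (\<lambda>j. if j \<le> b then A else {undefined})"
      by (auto simp: PiE_iff extensional_def split: if_splits)
    moreover have "compactin (product_topology (\<lambda>_. euclidean) UNIV)
        (PiE (UNIV :: nat set) (\<lambda>j. if j \<le> b then A else {undefined}))"
      unfolding compactin_PiE using that by simp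
    ultimately show ?thesis
      by (simp add: euclidean_product_topology)
  qed
  then have "compactin (product_topology (\<lambda>_. euclidean) UNIV) (node_space \<beta> U)"
    unfolding node_space_def compactin_PiE using compact_factor[OF assms] by simp
  then show ?thesis
    by (simp add: euclidean_product_topology)
qed

lemma exists_inj_choice:
  assumes "\<And>j. j \<le> b \<Longrightarrow> infinite (B j)"
  shows "\<exists>g. inj_on g {..b} \<and> (\<forall>j\<le>b::nat. g j \<in> B j)"
  using assms
proof (induction b)
  case 0
  then obtain t where "t \<in> B 0"
    using infinite_imp_nonempty by blast
  then show ?case
    by (intro exI[of _ "\<lambda>_. t"]) auto
next
  case (Suc b)
  then obtain g where g: "inj_on g {..b}" "\<forall>j\<le>b. g j \<in> B j"
    by auto
  have "infinite (B (Suc b) - g ` {..b})"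
    using Suc.prems by simp
  then obtain t where "t \<in> B (Suc b)" "t \<notin> g ` {..b}"
    using infinite_imp_nonempty by blast
  then have "inj_on (g(Suc b := t)) {..Suc b}" "\<forall>j\<le>Suc b. (g(Suc b := t)) j \<in> B j"
    using g by (auto simp: atMost_Suc inj_on_def le_Suc_eq)
  then show ?case
    by blast
qed

lemma distinct_node_space_dense:
  fixes U :: "('k::metric_space ^ 'n::finite) set"
  assumes U: "cartesian U" and x: "x \<in> node_space \<beta> U"
  obtains y where "\<And>n. y n \<in> distinct_node_space \<beta> U" "y \<longlonglongrightarrow> x"
proof -
  have "\<exists>y \<in> distinct_node_space \<beta> U. \<forall>i. \<forall>j\<le>\<beta> i. dist (y i j) (x i j) < e" if "0 < e" for e
  proof -
    have "\<exists>g. inj_on g {..\<beta> i} \<and> (\<forall>j\<le>\<beta> i. g j \<in> factor U i \<inter> ball (x i j) e)" for i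
      using x that by (intro exists_inj_choice infinite_ball_factor[OF U]) (auto simp: mem_node_space)
    then obtain g where g: "\<And>i. inj_on (g i) {..\<beta> i}"
      "\<And>i j. j \<le> \<beta> i \<Longrightarrow> g i j \<in> factor U i \<inter> ball (x i j) e"
      by metis
    then have "(\<lambda>i. restrict (g i) {..\<beta> i}) \<in> distinct_node_space \<beta> U"
      by (auto simp: mem_distinct_node_space mem_node_space inj_on_def)
    then show ?thesis
      using g(2) by (intro bexI[of _ "\<lambda>i. restrict (g i) {..\<beta> i}"]) (auto simp: dist_commute)
  qed
  then have "\<forall>n. \<exists>y. y \<in> distinct_node_space \<beta> U \<and> (\<forall>i. \<forall>j\<le>\<beta> i. dist (y i j) (x i j) < 1 / real (Suc n))"
    by (simp add: Bex_def)
  then obtain y where y: "\<And>n. y n \<in> distinct_node_space \<beta> U"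
    "\<And>n i j. j \<le> \<beta> i \<Longrightarrow> dist (y n i j) (x i j) < 1 / real (Suc n)"
    by metis
  have "y \<longlonglongrightarrow> x"
  proof (rule tendsto_node_space[OF x])
    show "y n \<in> node_space \<beta> U" for n
      using y(1) by (simp add: mem_distinct_node_space)
    show "(\<lambda>n. dist (y n i j) (x i j)) \<longlonglongrightarrow> 0" if "j \<le> \<beta> i" for i j
      using y(2)[OF that]
      by (intro tendsto_sandwich[OF _ _ tendsto_const LIMSEQ_inverse_real_of_nat])
        (auto intro!: always_eventually less_imp_le simp: inverse_eq_divide)
  qed
  then show ?thesis
    using that y(1) by blast
qed

text \<open>Carries an estimate known for distinct nodes over to coinciding nodes, by continuity and
  density.\<close>

lemma mem_closed_of_distinct:
  fixes U :: "('k::metric_space ^ 'n::finite) set"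
  assumes U: "cartesian U" and g: "continuous_on (node_space \<beta> U) g" and M: "closed M"
    and distinct: "\<And>x. x \<in> distinct_node_space \<beta> U \<Longrightarrow> g x \<in> M" and x: "x \<in> node_space \<beta> U"
  shows "g x \<in> M"
proof -
  obtain y where y: "\<And>n. y n \<in> distinct_node_space \<beta> U" "y \<longlonglongrightarrow> x"
    using distinct_node_space_dense[OF U x] by blast
  then have "(\<lambda>n. g (y n)) \<longlonglongrightarrow> g x"
    using g x by (intro continuous_on_tendsto_compose[OF g])
      (auto simp: mem_distinct_node_space)
  then show ?thesis
    using M distinct[OF y(1)] by (intro Lim_in_closed_set[of M]) auto
qed

text \<open>For \<open>x\<close> outside \<open>M\<close> the open set of all \<open>y\<close> with
  \<open>x - y\<close> in \<open>M\<close> contains \<open>x\<close> and misses \<open>M\<close>;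
  otherwise \<open>x = (x - y) + y\<close> would lie in \<open>M\<close>.\<close>

lemma closed_open_subgroup:
  fixes M :: "'e::topological_ab_group_add set"
  assumes "open M" "\<And>x y. x \<in> M \<Longrightarrow> y \<in> M \<Longrightarrow> x + y \<in> M"  "0 \<in> M"
  shows "closed M"
proof -
  have "\<exists>T. open T \<and> x \<in> T \<and> T \<subseteq> - M" if "x \<notin> M" for x
  proof (intro exI conjI)
    show "open ((\<lambda>y. x - y) -` M)"
      using assms(1) by (intro open_vimage continuous_on_diff continuous_on_const continuous_on_id)
    show "x \<in> (\<lambda>y. x - y) -` M"
      using assms(3) by simp
    show "(\<lambda>y. x - y) -` M \<subseteq> - M"
      using assms(2)[of "x - _"] that by fastforce
  qed
  then show ?thesis
    unfolding closed_def by (subst open_subopen) auto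
qed

text \<open>Uniform continuity relative to a neighbourhood \<open>M\<close> of 0, as the target
  carries no metric. If it fails, pairs of tuples at distance at most \<open>1 / Suc n\<close>
  violate it; by sequential compactness they have a common limit along a subsequence, where
  continuity gives a contradiction.\<close>

lemma uniformly_close_on_node_space:
  fixes U :: "('k::metric_space ^ 'n::finite) set"
    and g :: "('n \<Rightarrow> nat \<Rightarrow> 'k) \<Rightarrow> 'e::topological_ab_group_add"
  assumes U: "compact U" and g: "continuous_on (node_space \<beta> U) g" and M: "open M" "0 \<in> M"
  obtains \<delta> where "0 < \<delta>" "\<And>x y. x \<in> node_space \<beta> U \<Longrightarrow> y \<in> node_space \<beta> U \<Longrightarrow>
    (\<And>i j. j \<le> \<beta> i \<Longrightarrow> dist (x i j) (y i j) \<le> \<delta>) \<Longrightarrow> g x - g y \<in> M"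
proof (rule ccontr)
  assume contr: "\<not> thesis"
  let ?N = "node_space \<beta> U"
  have "\<exists>x y. x \<in> ?N \<and> y \<in> ?N \<and> (\<forall>i j. j \<le> \<beta> i \<longrightarrow> dist (x i j) (y i j) \<le> 1 / real (Suc n)) \<and> g x - g y \<notin> M" for n
    using contr that[of "1 / real (Suc n)"] by fastforce
  then obtain x y where xy: "\<And>n. x n \<in> ?N" "\<And>n. y n \<in> ?N" "\<And>n. g (x n) - g (y n) \<notin> M"
    "\<And>n i j. j \<le> \<beta> i \<Longrightarrow> dist (x n i j) (y n i j) \<le> 1 / real (Suc n)"
    by metis
  have N: "seq_compact ?N"
    using compact_node_space[OF U] by (rule compact_imp_seq_compact)
  obtain l r where l: "l \<in> ?N" "strict_mono r" "(x \<circ> r) \<longlonglongrightarrow> l"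
    by (rule seq_compactE[OF N allI[OF xy(1)]])
  have y: "(y \<circ> r) \<longlonglongrightarrow> l"
  proof (rule tendsto_node_space[OF l(1)])
    show "(y \<circ> r) n \<in> ?N" for n
      using xy(2) by simp
    fix i j assume j: "j \<le> \<beta> i"
    have "(\<lambda>n. (x \<circ> r) n i j) \<longlonglongrightarrow> l i j"
      by (rule continuous_on_tendsto_compose[OF continuous_on_coordinate2 l(3), of UNIV]) auto
    then have x0: "(\<lambda>n. dist ((x \<circ> r) n i j) (l i j)) \<longlonglongrightarrow> 0"
      by (simp add: tendsto_dist_0_iff[symmetric])
    have "(\<lambda>n. inverse (real (Suc (r n)))) \<longlonglongrightarrow> 0"
      using LIMSEQ_subseq_LIMSEQ[OF LIMSEQ_inverse_real_of_nat l(2)] by (simp add: o_def)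
    from tendsto_add[OF this x0]
    have lim: "(\<lambda>n. inverse (real (Suc (r n))) + dist ((x \<circ> r) n i j) (l i j)) \<longlonglongrightarrow> 0"
      by simp
    have "dist ((y \<circ> r) n i j) (l i j) \<le> inverse (real (Suc (r n))) + dist ((x \<circ> r) n i j) (l i j)" for n
      using xy(4)[OF j, of "r n"] dist_triangle3[of "y (r n) i j" "l i j" "x (r n) i j"]
      by (simp add: inverse_eq_divide)
    then have "(\<lambda>n. (y \<circ> r) n i j) \<longlonglongrightarrow> l i j"
      by (rule tendsto_dist_le[OF lim])
    then show "(\<lambda>n. dist ((y \<circ> r) n i j) (l i j)) \<longlonglongrightarrow> 0"
      by (simp add: tendsto_dist_0_iff[symmetric])
  qed
  have "(\<lambda>n. g ((x \<circ> r) n)) \<longlonglongrightarrow> g l" "(\<lambda>n. g ((y \<circ> r) n)) \<longlonglongrightarrow> g l"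
    using xy by (intro continuous_on_tendsto_compose[OF g _ l(1)] l(3) y; simp)+
  then have "(\<lambda>n. g ((x \<circ> r) n) - g ((y \<circ> r) n)) \<longlonglongrightarrow> g l - g l"
    by (rule tendsto_diff)
  then have "\<forall>\<^sub>F n in sequentially. g ((x \<circ> r) n) - g ((y \<circ> r) n) \<in> M"
    using M by (intro topological_tendstoD[where l = "g l - g l"]) auto
  then show False
    using xy(3) by (simp add: eventually_sequentially)
qed

text \<open>Distinct nodes make the multi-indices correspond bijectively to the points of the grid.
  This is what permits sets of nodes in place of tuples.\<close>

lemma divided_difference_eq_mdd:
  fixes x :: "'n::finite \<Rightarrow> nat \<Rightarrow> 'k::field"
  assumes inj: "\<And>i. inj_on (x i) {..\<beta> i}"
  shows "divided_difference smul \<beta> f x = mdd smul f (\<lambda>i. x i ` {..\<beta> i})"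
proof -
  let ?J = "{j. \<forall>i. j i \<le> \<beta> i}" and ?X = "\<lambda>i. x i ` {..\<beta> i}"
  let ?h = "\<lambda>j i. x i (j i)"
  have "bij_betw ?h ?J (PiE UNIV ?X)"
    unfolding bij_betw_def
  proof
    show "inj_on ?h ?J"
    proof (rule inj_onI, rule ext)
      fix j j' i assume "j \<in> ?J" "j' \<in> ?J" "?h j = ?h j'"
      then show "j i = j' i"
        using inj_onD[OF inj[of i], of "j i" "j' i"] by (auto dest: fun_cong[of _ _ i])
    qed
    show "?h ` ?J = PiE UNIV ?X"
    proof
      show "PiE UNIV ?X \<subseteq> ?h ` ?J"
      proof
        fix c assume "c \<in> PiE UNIV ?X"
        then have "\<forall>i. \<exists>j. j \<le> \<beta> i \<and> c i = x i j"
          by (auto simp: PiE_iff image_iff)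
        then obtain j where "\<And>i. j i \<le> \<beta> i" "\<And>i. c i = x i (j i)"
          by metis
        then show "c \<in> ?h ` ?J"
          by (intro image_eqI[of _ _ j]) auto
      qed
    qed auto
  qed
  then have "mdd smul f ?X = (\<Sum>j\<in>?J. smul (\<Prod>i\<in>UNIV. \<Prod>t\<in>?X i - {?h j i}. 1 / (?h j i - t)) (f (vec_lambda (?h j))))"
    unfolding mdd_def by (simp add: sum.reindex_bij_betw[symmetric])
  also have "\<dots> = divided_difference smul \<beta> f x"
    unfolding divided_difference_def
  proof (intro sum.cong refl arg_cong2[where f = smul] prod.cong)
    fix j i assume "j \<in> ?J"
    then have "?X i - {x i (j i)} = x i ` ({..\<beta> i} - {j i})"
      using inj_on_image_set_diff[OF inj[of i], of "{..\<beta> i}" "{j i}"] by auto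
    moreover have "inj_on (x i) ({..\<beta> i} - {j i})"
      using inj by (rule inj_on_subset) auto
    ultimately show "(\<Prod>t\<in>?X i - {x i (j i)}. 1 / (x i (j i) - t)) =
        (\<Prod>k\<in>{..\<beta> i} - {j i}. 1 / (x i (j i) - x i k))"
      by (simp add: prod.reindex)
  qed
  finally show ?thesis ..
qed

lemma exists_enumeration:
  assumes "finite S" "S \<noteq> {}"
  shows "\<exists>h. h \<in> extensional {..card S - 1} \<and> inj_on h {..card S - 1} \<and> h ` {..card S - 1} = S"
proof -
  obtain h where "bij_betw h {0..<card S} S"
    using ex_bij_betw_nat_finite[OF assms(1)] by blast
  moreover have "{0..<card S} = {..card S - 1}"
    using assms card_gt_0_iff[of S] by auto
  ultimately have "inj_on h {..card S - 1}" "h ` {..card S - 1} = S"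
    by (simp_all add: bij_betw_def)
  then show ?thesis
    by (intro exI[of _ "restrict h {..card S - 1}"]) auto
qed

lemma finite_multiindices: "finite {\<beta> :: 'n::finite \<Rightarrow> nat. \<forall>i. \<beta> i \<le> a i}"
proof -
  have "{\<beta>. \<forall>i. \<beta> i \<le> a i} = PiE UNIV (\<lambda>i. {..a i})"
    by auto
  then show ?thesis
    by (simp add: finite_PiE)
qed

text \<open>The other coordinates of \<open>X\<close> may have any admissible number of nodes, so a
  radius is needed that serves all orders \<open>\<beta> \<le> a\<close> at once.\<close>

lemma uniform_modulus:
  fixes smul :: "'k::ultrametric_field \<Rightarrow> 'e::topological_ab_group_add \<Rightarrow> 'e"
    and U :: "('k ^ 'n::finite) set"
  assumes U: "compact U" and f: "f \<in> C_alpha smul \<alpha> U" and a: "multiindex_le a \<alpha>"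
    and M: "open M" "0 \<in> M"
  obtains \<delta> where "0 < \<delta>" "\<delta> \<le> 1"
    "\<And>X i S S' t. admissible (factor U) a (X(i := S)) \<Longrightarrow> admissible (factor U) a (X(i := S')) \<Longrightarrow>
      card S = Suc (a i) \<Longrightarrow> card S' = Suc (a i) \<Longrightarrow> (\<And>s. s \<in> S \<union> S' \<Longrightarrow> dist s t \<le> \<delta>) \<Longrightarrow>
      mdd smul f (X(i := S)) - mdd smul f (X(i := S')) \<in> M"
proof -
  let ?B = "{\<beta>. \<forall>i. \<beta> i \<le> a i}"
  have "\<forall>\<beta>\<in>?B. \<exists>g. is_dd_extension smul \<beta> U f g"
  proof
    fix \<beta> assume "\<beta> \<in> ?B"
    then have "multiindex_le \<beta> \<alpha>"
      using a unfolding multiindex_le_def by (metis enat_ord_simps(1) mem_Collect_eq order_trans)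
    then show "\<exists>g. is_dd_extension smul \<beta> U f g"
      using f by (simp add: C_alpha_def)
  qed
  from bchoice[OF this] obtain g where g: "\<And>\<beta>. \<beta> \<in> ?B \<Longrightarrow> is_dd_extension smul \<beta> U f (g \<beta>)"
    by blast
  have "\<forall>\<beta>\<in>?B. \<exists>\<delta>>0. \<forall>x\<in>node_space \<beta> U. \<forall>y\<in>node_space \<beta> U.
      (\<forall>i j. j \<le> \<beta> i \<longrightarrow> dist (x i j) (y i j) \<le> \<delta>) \<longrightarrow> g \<beta> x - g \<beta> y \<in> M"
  proof
    fix \<beta> assume "\<beta> \<in> ?B"
    then have "continuous_on (node_space \<beta> U) (g \<beta>)"
      using g by (auto simp: is_dd_extension_def continuous_maps_def)
    from uniformly_close_on_node_space[OF U this M]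
    show "\<exists>\<delta>>0. \<forall>x\<in>node_space \<beta> U. \<forall>y\<in>node_space \<beta> U.
        (\<forall>i j. j \<le> \<beta> i \<longrightarrow> dist (x i j) (y i j) \<le> \<delta>) \<longrightarrow> g \<beta> x - g \<beta> y \<in> M"
      by metis
  qed
  from bchoice[OF this] obtain d where d: "\<And>\<beta>. \<beta> \<in> ?B \<Longrightarrow> 0 < d \<beta>"
    "\<And>\<beta> x y. \<beta> \<in> ?B \<Longrightarrow> x \<in> node_space \<beta> U \<Longrightarrow> y \<in> node_space \<beta> U \<Longrightarrow>
      (\<And>i j. j \<le> \<beta> i \<Longrightarrow> dist (x i j) (y i j) \<le> d \<beta>) \<Longrightarrow> g \<beta> x - g \<beta> y \<in> M"
    by blast
  \<comment> \<open>There are finitely many orders up to \<open>a\<close>, so the minimum is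
    positive; inserting 1 ensures \<open>\<delta> \<le> 1\<close>.\<close>
  define \<delta> where "\<delta> = Min (insert 1 (d ` ?B))"
  have fin: "finite (insert 1 (d ` ?B))"
    by (intro finite.insertI finite_imageI finite_multiindices)
  have \<delta>: "0 < \<delta>" "\<delta> \<le> 1"
    using fin d(1) by (simp_all add: \<delta>_def)
  have \<delta>_le: "\<delta> \<le> d \<beta>" if "\<beta> \<in> ?B" for \<beta>
    unfolding \<delta>_def using fin that by (intro Min_le) auto
  show thesis
  proof (rule that[OF \<delta>])
    fix X :: "'n \<Rightarrow> 'k set" and i S S' t
    assume adm: "admissible (factor U) a (X(i := S))" "admissible (factor U) a (X(i := S'))"
      and card: "card S = Suc (a i)" "card S' = Suc (a i)"
      and near: "\<And>s. s \<in> S \<union> S' \<Longrightarrow> dist s t \<le> \<delta>"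
    \<comment> \<open>A set of \<open>m\<close> nodes is enumerated by the indices up to
      \<open>m - 1\<close>; no set is empty, so nothing is lost by truncated subtraction.
      \<open>S\<close> and \<open>S'\<close> have equal size, so the same \<beta> serves
      both.\<close>
    define \<beta> where "\<beta> k = card ((X(i := S)) k) - 1" for k
    have \<beta>: "\<beta> \<in> ?B"
      using adm(1) unfolding admissible_def \<beta>_def by (simp add: le_diff_conv split: if_splits)
    have "\<exists>h. h \<in> extensional {..\<beta> k} \<and> inj_on h {..\<beta> k} \<and> h ` {..\<beta> k} = (X(i := S)) k" for k
      unfolding \<beta>_def using adm(1) by (intro exists_enumeration) (simp_all add: admissible_def)
    then obtain x where x: "\<And>k. x k \<in> extensional {..\<beta> k}" "\<And>k. inj_on (x k) {..\<beta> k}"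
      "\<And>k. x k ` {..\<beta> k} = (X(i := S)) k"
      by metis
    have "\<beta> i = card S' - 1" "finite S'" "S' \<noteq> {}"
      using card adm(2) unfolding admissible_def \<beta>_def by (auto split: if_splits dest: spec[of _ i])
    then obtain h where h: "h \<in> extensional {..\<beta> i}" "inj_on h {..\<beta> i}" "h ` {..\<beta> i} = S'"
      using exists_enumeration by metis
    \<comment> \<open>Only block \<open>i\<close> is replaced. Its entries and those of
      \<open>x\<close> lie in a common ball of radius \<delta>, so any enumeration of
      \<open>S'\<close> will do.\<close>
    define y where "y = x(i := h)"
    have y: "\<And>k. y k \<in> extensional {..\<beta> k}" "\<And>k. inj_on (y k) {..\<beta> k}"
      "\<And>k. y k ` {..\<beta> k} = (X(i := S')) k"
      using x h by (auto simp: y_def)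
    have sub: "(X(i := S)) k \<subseteq> factor U k" "(X(i := S')) k \<subseteq> factor U k" for k
      using adm unfolding admissible_def by blast+
    have mem: "x \<in> distinct_node_space \<beta> U" "y \<in> distinct_node_space \<beta> U"
      unfolding mem_distinct_node_space mem_node_space using x y sub by blast+
    have "dist (x k j) (y k j) \<le> d \<beta>" if "j \<le> \<beta> k" for k j
    proof (cases "k = i")
      case True
      then have "x k j \<in> S" "y k j \<in> S'"
        using that x(3)[of i] y(3)[of i] by auto
      then have "dist (x k j) t \<le> \<delta>" "dist t (y k j) \<le> \<delta>"
        using near[of "x k j"] near[of "y k j"] by (simp_all add: dist_commute[of t])
      then show ?thesis
        using dist_ultrametric_le \<delta>_le[OF \<beta>] by (meson order_trans)
    next
      case False
      then show ?thesis
        using d(1)[OF \<beta>] by (simp add: y_def)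
    qed
    then have "g \<beta> x - g \<beta> y \<in> M"
      using mem by (intro d(2)[OF \<beta>]) (auto simp: mem_distinct_node_space)
    moreover have "(\<lambda>k. x k ` {..\<beta> k}) = X(i := S)" "(\<lambda>k. y k ` {..\<beta> k}) = X(i := S')"
      using x(3) y(3) by (intro ext, simp only:)+
    then have "g \<beta> x = mdd smul f (X(i := S))" "g \<beta> y = mdd smul f (X(i := S'))"
      using g[OF \<beta>] mem divided_difference_eq_mdd[of x \<beta> smul f, OF x(2)]
        divided_difference_eq_mdd[of y \<beta> smul f, OF y(2)]
      by (simp_all add: is_dd_extension_def)
    ultimately show "mdd smul f (X(i := S)) - mdd smul f (X(i := S')) \<in> M"
      by simp
  qed
qed

section \<open>Locally polynomial functions\<close>

lemma polynomial_on_subset: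
  "polynomial_on smul \<alpha> V f \<Longrightarrow> W \<subseteq> V \<Longrightarrow> polynomial_on smul \<alpha> W f"
  unfolding polynomial_on_def by blast

lemma LocPol_uniform:
  fixes smul :: "'k::ultrametric_field \<Rightarrow> 'e::ab_group_add \<Rightarrow> 'e" and U :: "('k ^ 'n::finite) set"
  assumes U: "compact U" and f: "f \<in> LocPol smul \<alpha> U"
  obtains \<delta> where "0 < \<delta>"
    "\<And>x. x \<in> U \<Longrightarrow> polynomial_on smul \<alpha> {y \<in> U. \<forall>i. dist (y $ i) (x $ i) \<le> \<delta>} f"
proof -
  let ?\<T> = "{T. open T \<and> polynomial_on smul \<alpha> (U \<inter> T) f}"
  have "U \<subseteq> \<Union>?\<T>"
  proof
    fix x assume "x \<in> U"
    then obtain V where V: "openin (top_of_set U) V" "x \<in> V" "polynomial_on smul \<alpha> V f"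
      using f unfolding LocPol_def by blast
    then obtain T where "open T" "V = U \<inter> T"
      by (auto simp: openin_open)
    then show "x \<in> \<Union>?\<T>"
      using V by blast
  qed
  then obtain e where e: "0 < e" "\<And>x. x \<in> U \<Longrightarrow> \<exists>T\<in>?\<T>. ball x e \<subseteq> T"
    using Heine_Borel_lemma[OF U, of ?\<T>] by blast
  \<comment> \<open>\<open>e\<close> is a Lebesgue number of the cover. The distance of vectors is
    Euclidean and bounded by the sum of the coordinate distances, hence the division by more than
    the dimension.\<close>
  define \<delta> where "\<delta> = e / (real CARD('n) + 1)"
  have \<delta>: "0 < \<delta>" "real CARD('n) * \<delta> < e"
    using e(1) by (simp_all add: \<delta>_def divide_less_eq)
  show thesis
  proof (rule that[OF \<delta>(1)])
    fix x assume "x \<in> U"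
    then obtain T where T: "polynomial_on smul \<alpha> (U \<inter> T) f" "ball x e \<subseteq> T"
      using e(2) by blast
    have "{y \<in> U. \<forall>i. dist (y $ i) (x $ i) \<le> \<delta>} \<subseteq> U \<inter> T"
    proof
      fix y assume "y \<in> {y \<in> U. \<forall>i. dist (y $ i) (x $ i) \<le> \<delta>}"
      then have "y \<in> U" and y: "\<forall>i. dist (y $ i) (x $ i) \<le> \<delta>"
        by auto
      have "dist x y \<le> (\<Sum>i\<in>UNIV. dist (x $ i) (y $ i))"
        unfolding dist_vec_def by (rule L2_set_le_sum) simp
      also have "\<dots> \<le> (\<Sum>i\<in>(UNIV :: 'n set). \<delta>)"
        using y by (intro sum_mono) (simp add: dist_commute)
      also have "\<dots> < e"
        using \<delta>(2) by simp
      finally show "y \<in> U \<inter> T"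
        using T(2) \<open>y \<in> U\<close> by auto
    qed
    then show "polynomial_on smul \<alpha> {y \<in> U. \<forall>i. dist (y $ i) (x $ i) \<le> \<delta>} f"
      by (rule polynomial_on_subset[OF T(1)])
  qed
qed

text \<open>Points of the same ball define the same choice predicate, so \<open>SOME\<close> returns
  the same representative. Total boundedness leaves finitely many.\<close>

lemma ball_representatives:
  fixes A :: "'k::ultrametric_field set"
  assumes A: "compact A" and \<delta>: "0 < \<delta>"
  obtains \<rho> where "finite (\<rho> ` A)" "\<And>t. t \<in> A \<Longrightarrow> \<rho> t \<in> A \<and> dist t (\<rho> t) \<le> \<delta>"
    "\<And>s t. s \<in> A \<Longrightarrow> t \<in> A \<Longrightarrow> dist s t \<le> \<delta> \<Longrightarrow> \<rho> s = \<rho> t"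
proof -
  define \<rho> where "\<rho> t = (SOME s. s \<in> A \<and> dist s t \<le> \<delta>)" for t
  have 1: "\<rho> t \<in> A \<and> dist (\<rho> t) t \<le> \<delta>" if "t \<in> A" for t
    unfolding \<rho>_def by (rule someI[of _ t]) (use that \<delta> in simp)
  have 2: "\<rho> s = \<rho> t" if "dist s t \<le> \<delta>" for s t
  proof -
    have "dist u s \<le> \<delta> \<longleftrightarrow> dist u t \<le> \<delta>" for u
      using that dist_ultrametric_le by (metis dist_commute)
    then show ?thesis
      by (simp add: \<rho>_def)
  qed
  obtain K where K: "finite K" "A \<subseteq> (\<Union>x\<in>K. ball x \<delta>)"
    using seq_compact_imp_totally_bounded[OF compact_imp_seq_compact[OF A]] \<delta> by blast
  have "\<rho> ` A \<subseteq> \<rho> ` K"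
  proof
    fix r assume "r \<in> \<rho> ` A"
    then obtain t where t: "t \<in> A" "r = \<rho> t"
      by blast
    then obtain x where "x \<in> K" "dist x t < \<delta>"
      using K(2) by auto
    then show "r \<in> \<rho> ` K"
      using 2[of x t] t by (metis imageI less_imp_le)
  qed
  then have "finite (\<rho> ` A)"
    using K(1) finite_surj by blast
  then show thesis
    using 1 2 by (intro that[of \<rho>]) (auto simp: dist_commute)
qed

lemma exists_interpolation_nodes:
  fixes A :: "'k::ultrametric_field set"
  assumes A: "\<And>t e. t \<in> A \<Longrightarrow> 0 < e \<Longrightarrow> infinite (A \<inter> ball t e)" and \<delta>: "0 < \<delta>"
  shows "\<exists>C. (\<forall>t\<in>A. finite (C t) \<and> card (C t) = Suc k \<and> C t \<subseteq> A \<and> (\<forall>s\<in>C t. dist s t \<le> \<delta>)) \<and>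
    (\<forall>s t. dist s t \<le> \<delta> \<longrightarrow> C s = C t)"
proof -
  define C where "C t = (SOME S. finite S \<and> card S = Suc k \<and> S \<subseteq> {s \<in> A. dist s t \<le> \<delta>})" for t
  have 1: "finite (C t) \<and> card (C t) = Suc k \<and> C t \<subseteq> {s \<in> A. dist s t \<le> \<delta>}" if "t \<in> A" for t
  proof -
    have "A \<inter> ball t \<delta> \<subseteq> {s \<in> A. dist s t \<le> \<delta>}"
      by (auto simp: dist_commute)
    then have "infinite {s \<in> A. dist s t \<le> \<delta>}"
      using A[OF that \<delta>] finite_subset by blast
    from infinite_arbitrarily_large[OF this, of "Suc k"] show ?thesis
      unfolding C_def by (rule someI_ex)
  qed
  have 2: "C s = C t" if "dist s t \<le> \<delta>" for s t
  proof -
    have "dist u s \<le> \<delta> \<longleftrightarrow> dist u t \<le> \<delta>" for u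
      using that dist_ultrametric_le by (metis dist_commute)
    then show ?thesis
      by (simp add: C_def)
  qed
  show ?thesis
    using 1 2 by (intro exI[of _ C]) blast
qed

lemma node_space_mono: "V \<subseteq> U \<Longrightarrow> node_space \<beta> V \<subseteq> node_space \<beta> U"
  and distinct_node_space_mono: "V \<subseteq> U \<Longrightarrow> distinct_node_space \<beta> V \<subseteq> distinct_node_space \<beta> U"
proof -
  assume "V \<subseteq> U"
  then show *: "node_space \<beta> V \<subseteq> node_space \<beta> U"
    unfolding node_space_def by (intro PiE_mono image_mono) auto
  then show "distinct_node_space \<beta> V \<subseteq> distinct_node_space \<beta> U"
    by (auto simp: distinct_node_space_def)
qed

lemma vec_lambda_mem_cartesian:
  fixes U :: "('k::topological_space ^ 'n::finite) set"
  assumes "cartesian U" "x \<in> node_space \<beta> U" "\<And>i. c i \<in> x i ` {..\<beta> i}"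
  shows "vec_lambda c \<in> U"
  using assms unfolding mem_cartesian_iff[OF assms(1)] mem_node_space
  by (auto simp del: image_iff) (metis atMost_iff imageE)

section \<open>Locally polynomial functions are C^\<alpha>\<close>

sublocale hausdorff_tvs \<subseteq> ultrametric_vector_space smul
  by unfold_locales

context hausdorff_tvs
begin

lemma continuous_on_smul:
  assumes "continuous_on S c" "continuous_on S v"
  shows "continuous_on S (\<lambda>x. smul (c x) (v x))"
  using continuous_on_compose2[OF continuous_smul continuous_on_Pair[OF assms]] by simp

lemma divided_difference_eq_mdd':
  "x \<in> distinct_node_space \<beta> U \<Longrightarrow> divided_difference smul \<beta> f x = mdd smul f (\<lambda>i. x i ` {..\<beta> i})"
  by (rule divided_difference_eq_mdd) (simp add: mem_distinct_node_space)

lemma divided_difference_cong: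
  assumes U: "cartesian U" and x: "x \<in> distinct_node_space \<beta> U" and eq: "\<And>u. u \<in> U \<Longrightarrow> f u = g u"
  shows "divided_difference smul \<beta> f x = divided_difference smul \<beta> g x"
  unfolding divided_difference_eq_mdd'[OF x]
  using x vec_lambda_mem_cartesian[OF U] by (intro mdd_cong eq) (auto simp: mem_distinct_node_space)

lemma is_dd_extension_restrict:
  assumes V: "cartesian V" "V \<subseteq> U" and g: "is_dd_extension smul \<beta> U f g"
  shows "is_dd_extension smul \<beta> V (restrict f V) (restrict g (node_space \<beta> V))"
  unfolding is_dd_extension_def continuous_maps_def
proof (intro conjI ballI CollectI)
  have "continuous_on (node_space \<beta> V) g"
    using g node_space_mono[OF V(2)] unfolding is_dd_extension_def continuous_maps_def
    by (blast intro: continuous_on_subset)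
  then show "continuous_on (node_space \<beta> V) (restrict g (node_space \<beta> V))"
    by (simp cong: continuous_on_cong)
next
  fix x assume x: "x \<in> distinct_node_space \<beta> V"
  then have "g x = divided_difference smul \<beta> f x"
    using g distinct_node_space_mono[OF V(2)] unfolding is_dd_extension_def by blast
  also have "\<dots> = divided_difference smul \<beta> (restrict f V) x"
    by (rule divided_difference_cong[OF V(1) x]) simp
  finally show "restrict g (node_space \<beta> V) x = divided_difference smul \<beta> (restrict f V) x"
    using x by (simp add: mem_distinct_node_space)
qed simp

lemma is_dd_extension_dd_extension:
  assumes "f \<in> C_alpha smul \<alpha> U" "multiindex_le \<beta> \<alpha>" "cartesian V" "V \<subseteq> U"
  shows "is_dd_extension smul \<beta> V (restrict f V) (dd_extension smul \<beta> V (restrict f V))"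
proof -
  obtain g where "is_dd_extension smul \<beta> U f g"
    using assms(1,2) unfolding C_alpha_def by blast
  then have "\<exists>g. is_dd_extension smul \<beta> V (restrict f V) g"
    using is_dd_extension_restrict[OF assms(3,4)] by blast
  then show ?thesis
    unfolding dd_extension_def by (rule someI_ex)
qed

text \<open>Unlike \<open>is_dd_extension\<close>, this does not require the witness to be undefined
  outside the node space; witnesses can then be added and multiplied, and the final one is
  restricted.\<close>

definition mdd_extendable :: "('n \<Rightarrow> nat) \<Rightarrow> ('k ^ 'n::finite) set \<Rightarrow> ('k ^ 'n \<Rightarrow> 'e) \<Rightarrow> bool" where
  "mdd_extendable \<beta> U f \<longleftrightarrow> (\<exists>G. continuous_on (node_space \<beta> U) G \<and>
     (\<forall>x\<in>distinct_node_space \<beta> U. G x = mdd smul f (\<lambda>i. x i ` {..\<beta> i})))"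

lemma mdd_extendable_sum:
  assumes "\<And>b. b \<in> B \<Longrightarrow> mdd_extendable \<beta> U (f b)"
  shows "mdd_extendable \<beta> U (\<lambda>x. \<Sum>b\<in>B. f b x)"
proof -
  have "\<forall>b\<in>B. \<exists>G. continuous_on (node_space \<beta> U) G \<and>
     (\<forall>x\<in>distinct_node_space \<beta> U. G x = mdd smul (f b) (\<lambda>i. x i ` {..\<beta> i}))"
    using assms unfolding mdd_extendable_def by blast
  from bchoice[OF this] obtain G where G: "\<And>b. b \<in> B \<Longrightarrow> continuous_on (node_space \<beta> U) (G b)"
    "\<And>b x. b \<in> B \<Longrightarrow> x \<in> distinct_node_space \<beta> U \<Longrightarrow> G b x = mdd smul (f b) (\<lambda>i. x i ` {..\<beta> i})"
    by blast
  show ?thesis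
    unfolding mdd_extendable_def mdd_sum
    using G by (intro exI[of _ "\<lambda>x. \<Sum>b\<in>B. G b x"]) (auto intro!: continuous_on_sum)
qed

lemma mdd_extendable_product:
  fixes \<phi> :: "'n::finite \<Rightarrow> 'k \<Rightarrow> 'k"
  assumes "\<And>i. dd_extendable (factor U i) (\<phi> i)"
  shows "mdd_extendable \<beta> U (\<lambda>x. smul (\<Prod>i\<in>UNIV. \<phi> i (x $ i)) e)"
proof -
  have "\<forall>i. \<exists>G. continuous_on {x. \<forall>m\<in>{..\<beta> i}. x m \<in> factor U i} G \<and>
      (\<forall>x. (\<forall>m\<in>{..\<beta> i}. x m \<in> factor U i) \<longrightarrow> inj_on x {..\<beta> i} \<longrightarrow> G x = dd (*) (\<phi> i) (x ` {..\<beta> i}))"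
    using assms finite_atMost unfolding dd_extendable_def by blast
  from choice[OF this] obtain G where G: "\<And>i. continuous_on {x. \<forall>m\<in>{..\<beta> i}. x m \<in> factor U i} (G i)"
    "\<And>i x. x \<in> {x. \<forall>m\<in>{..\<beta> i}. x m \<in> factor U i} \<Longrightarrow> inj_on x {..\<beta> i} \<Longrightarrow>
      G i x = dd (*) (\<phi> i) (x ` {..\<beta> i})"
    by blast
  have mem: "x i \<in> {x. \<forall>m\<in>{..\<beta> i}. x m \<in> factor U i}" if "x \<in> node_space \<beta> U" for x i
    using that by (simp add: mem_node_space)
  show ?thesis
    unfolding mdd_extendable_def
  proof (intro exI conjI ballI)
    have "continuous_on (node_space \<beta> U) (\<lambda>x. G i (x i))" for i
      by (rule continuous_on_compose2[OF G(1)
          continuous_on_subset[OF continuous_on_product_coordinates subset_UNIV]])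
        (use mem in blast)
    then show "continuous_on (node_space \<beta> U) (\<lambda>x. smul (\<Prod>i\<in>UNIV. G i (x i)) e)"
      by (intro continuous_on_smul continuous_on_prod' continuous_on_const)
  next
    fix x assume x: "x \<in> distinct_node_space \<beta> U"
    then have "G i (x i) = dd (*) (\<phi> i) (x i ` {..\<beta> i})" for i
      by (intro G(2) mem) (auto simp: mem_distinct_node_space)
    then show "smul (\<Prod>i\<in>UNIV. G i (x i)) e = mdd smul (\<lambda>x. smul (\<Prod>i\<in>UNIV. \<phi> i (x $ i)) e) (\<lambda>i. x i ` {..\<beta> i})"
      by (subst mdd_product) auto
  qed
qed

text \<open>At a uniform scale \<delta>, \<open>f\<close> is a finite sum over boxes of balls of a
  polynomial times the indicator of the box. Each monomial term is a product of one-variable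
  functions, to which the extension results apply.\<close>

lemma LocPol_subset_C_alpha:
  fixes U :: "('k ^ 'n::finite) set"
  assumes cU: "compact U" and U: "cartesian U"
  shows "LocPol smul \<alpha> U \<subseteq> C_alpha smul \<alpha> U"
proof
  fix f assume f: "f \<in> LocPol smul \<alpha> U"
  obtain \<delta> where \<delta>: "0 < \<delta>"
    "\<And>x. x \<in> U \<Longrightarrow> polynomial_on smul \<alpha> {y \<in> U. \<forall>i. dist (y $ i) (x $ i) \<le> \<delta>} f"
    using LocPol_uniform[OF cU f] by blast
  have "\<exists>\<rho>. finite (\<rho> ` factor U i) \<and> (\<forall>t\<in>factor U i. \<rho> t \<in> factor U i \<and> dist t (\<rho> t) \<le> \<delta>) \<and>
    (\<forall>s\<in>factor U i. \<forall>t\<in>factor U i. dist s t \<le> \<delta> \<longrightarrow> \<rho> s = \<rho> t)" for i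
    using ball_representatives[OF compact_factor[OF cU, of i] \<delta>(1)] by metis
  then obtain \<rho> where \<rho>: "\<And>i. finite (\<rho> i ` factor U i)"
    "\<And>i t. t \<in> factor U i \<Longrightarrow> \<rho> i t \<in> factor U i"
    "\<And>i t. t \<in> factor U i \<Longrightarrow> dist t (\<rho> i t) \<le> \<delta>"
    "\<And>i s t. s \<in> factor U i \<Longrightarrow> t \<in> factor U i \<Longrightarrow> dist s t \<le> \<delta> \<Longrightarrow> \<rho> i s = \<rho> i t"
    by metis
  let ?B = "PiE UNIV (\<lambda>i. \<rho> i ` factor U i)"
  let ?supp = "\<lambda>a. {\<beta>. multiindex_le \<beta> \<alpha> \<and> a \<beta> \<noteq> 0}"
  have "\<forall>b\<in>?B. \<exists>a. finite (?supp a) \<and> (\<forall>y\<in>{y \<in> U. \<forall>i. dist (y $ i) (b i) \<le> \<delta>}.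
      f y = (\<Sum>\<beta>\<in>?supp a. smul (\<Prod>i\<in>UNIV. (y $ i) ^ \<beta> i) (a \<beta>)))"
  proof
    fix b assume "b \<in> ?B"
    then have "b i \<in> \<rho> i ` factor U i" for i
      by (simp add: PiE_iff)
    then have "\<forall>i. b i \<in> factor U i"
      using \<rho>(2) by (metis (no_types, lifting) imageE)
    then have "vec_lambda b \<in> U"
      by (subst mem_cartesian_iff[OF U]) simp
    then show "\<exists>a. finite (?supp a) \<and> (\<forall>y\<in>{y \<in> U. \<forall>i. dist (y $ i) (b i) \<le> \<delta>}.
      f y = (\<Sum>\<beta>\<in>?supp a. smul (\<Prod>i\<in>UNIV. (y $ i) ^ \<beta> i) (a \<beta>)))"
      using \<delta>(2)[of "vec_lambda b"] by (simp add: polynomial_on_def)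
  qed
  from bchoice[OF this] obtain a where a: "\<And>b. b \<in> ?B \<Longrightarrow> finite (?supp (a b))"
    "\<And>b y. b \<in> ?B \<Longrightarrow> y \<in> U \<Longrightarrow> (\<And>i. dist (y $ i) (b i) \<le> \<delta>) \<Longrightarrow>
      f y = (\<Sum>\<beta>\<in>?supp (a b). smul (\<Prod>i\<in>UNIV. (y $ i) ^ \<beta> i) (a b \<beta>))"
    by blast
  \<comment> \<open>A power times the indicator of the ball with representative \<open>b i\<close>;
    the indicator is locally constant because \<open>\<rho> i\<close> is constant on balls.\<close>
  let ?\<phi> = "\<lambda>b \<beta> i t. t ^ \<beta> i * (if \<rho> i t = b i then 1 else 0)"
  let ?F = "\<lambda>y. \<Sum>b\<in>?B. \<Sum>\<beta>\<in>?supp (a b). smul (\<Prod>i\<in>UNIV. ?\<phi> b \<beta> i (y $ i)) (a b \<beta>)"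
  have eq: "f y = ?F y" if y: "y \<in> U" for y
  proof -
    \<comment> \<open>\<open>b0\<close> labels the box that contains \<open>y\<close>; every other
      summand has a vanishing indicator.\<close>
    define b0 where "b0 i = \<rho> i (y $ i)" for i
    have b0: "b0 \<in> ?B" "dist (y $ i) (b0 i) \<le> \<delta>" for i
      using y \<rho>(3) by (auto simp: b0_def)
    have "(\<Sum>\<beta>\<in>?supp (a b). smul (\<Prod>i\<in>UNIV. ?\<phi> b \<beta> i (y $ i)) (a b \<beta>)) =
        (if b = b0 then f y else 0)" if "b \<in> ?B" for b
    proof (cases "b = b0")
      case True
      then show ?thesis
        using a(2)[OF b0(1) y b0(2)] by (simp add: b0_def[symmetric])
    next
      case False
      then obtain i where "b i \<noteq> b0 i"
        by (auto simp: fun_eq_iff)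
      then have i: "\<rho> i (y $ i) \<noteq> b i"
        by (simp add: b0_def)
      have "(\<Prod>i\<in>UNIV. ?\<phi> b \<beta> i (y $ i)) = 0" for \<beta>
        using i by (intro prod_zero) auto
      then show ?thesis
        using False by (simp only: scale_zero_left sum.neutral_const if_False)
    qed
    then have "?F y = (\<Sum>b\<in>?B. if b = b0 then f y else 0)"
      by (intro sum.cong) auto
    also have "\<dots> = f y"
      using b0(1) \<rho>(1) by (simp add: finite_PiE)
    finally show ?thesis ..
  qed
  have "dd_extendable (factor U i) (?\<phi> b \<beta> i)" for b \<beta> i
  proof (rule dd_extendable_power_mult, rule dd_extendable_locally_constant[OF \<delta>(1)])
    fix s t assume "s \<in> factor U i" "t \<in> factor U i" "dist s t \<le> \<delta>"
    then have "\<rho> i s = \<rho> i t"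
      by (rule \<rho>(4))
    then show "(if \<rho> i s = b i then 1 else 0) = (if \<rho> i t = b i then 1 else (0 :: 'k))"
      by simp
  qed
  then have ext: "mdd_extendable \<beta> U ?F" for \<beta>
    by (intro mdd_extendable_sum mdd_extendable_product)
  have "\<exists>g. is_dd_extension smul \<beta> U f g" for \<beta>
  proof -
    obtain G where G: "continuous_on (node_space \<beta> U) G"
      "\<And>x. x \<in> distinct_node_space \<beta> U \<Longrightarrow> G x = mdd smul ?F (\<lambda>i. x i ` {..\<beta> i})"
      using ext unfolding mdd_extendable_def by blast
    have "is_dd_extension smul \<beta> U f (restrict G (node_space \<beta> U))"
      unfolding is_dd_extension_def continuous_maps_def
    proof (intro conjI ballI CollectI)
      show "continuous_on (node_space \<beta> U) (restrict G (node_space \<beta> U))"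
        using G(1) by (simp cong: continuous_on_cong)
      fix x assume x: "x \<in> distinct_node_space \<beta> U"
      have "divided_difference smul \<beta> f x = divided_difference smul \<beta> ?F x"
        by (rule divided_difference_cong[OF U x eq])
      then show "restrict G (node_space \<beta> U) x = divided_difference smul \<beta> f x"
        using x by (simp add: G(2) divided_difference_eq_mdd'[OF x] mem_distinct_node_space)
    qed simp
    then show ?thesis
      by blast
  qed
  then show "f \<in> C_alpha smul \<alpha> U"
    using f by (simp add: C_alpha_def LocPol_def)
qed

end

section \<open>Density\<close>

lemma multiindex_le_trans:
  "(\<And>i. \<beta> i \<le> a i) \<Longrightarrow> multiindex_le a \<alpha> \<Longrightarrow> multiindex_le \<beta> \<alpha>"
  unfolding multiindex_le_def by (meson enat_ord_simps(1) order_trans)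

lemma admissible_mono:
  "admissible A a X \<Longrightarrow> (\<And>i. a i \<le> b i) \<Longrightarrow> admissible A b X"
  unfolding admissible_def by (meson Suc_le_mono order_trans)

lemma dd_small_mono:
  assumes "dd_small smul A b M f" "\<And>i. a i \<le> b i" "M \<subseteq> N"
  shows "dd_small smul A a N f"
  using assms admissible_mono unfolding dd_small_def by blast

context grid_interpolation
begin

lemma interpolate_polynomial:
  assumes a: "multiindex_le a \<alpha>" and x0: "\<And>i. x0 $ i \<in> A i"
    and V: "\<And>x i. x \<in> V \<Longrightarrow> x $ i \<in> A i \<and> dist (x $ i) (x0 $ i) \<le> \<delta>"
  shows "polynomial_on smul \<alpha> V (interpolate smul C UNIV f)"
proof -
  let ?D = "\<lambda>i. C i (x0 $ i)" and ?B = "PiE UNIV (\<lambda>i. {..a i})"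
  have D: "finite (?D i)" "card (?D i) = Suc (a i)" for i
    using local_interpolation.finite_nodes[OF coord x0] local_interpolation.card_nodes[OF coord x0] by auto
  \<comment> \<open>The coefficients are chosen for pairs of a coordinate and a node, so that a
    single application of choice suffices; the implication is vacuous for non-nodes.\<close>
  have "\<forall>p. \<exists>l. snd p \<in> ?D (fst p) \<longrightarrow>
      (\<forall>t. lagrange_basis (?D (fst p)) (snd p) t = (\<Sum>m\<le>a (fst p). l m * t ^ m))"
    using lagrange_basis_polynomial[OF D(1) _ D(2)] by blast
  from choice[OF this] obtain l where
    l: "\<And>i c t. c \<in> ?D i \<Longrightarrow> lagrange_basis (?D i) c t = (\<Sum>m\<le>a i. l (i, c) m * t ^ m)"
    by fastforce
  define e where "e \<beta> = (\<Sum>c\<in>PiE UNIV ?D. smul (\<Prod>i\<in>UNIV. l (i, c i) (\<beta> i)) (f (vec_lambda c)))" for \<beta>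
  \<comment> \<open>Outside the finite box given by \<open>a\<close> the coefficients are set to 0,
    which keeps the support finite.\<close>
  define e' where "e' \<beta> = (if \<beta> \<in> ?B then e \<beta> else 0)" for \<beta>
  have finB: "finite ?B"
    by (intro finite_PiE) auto
  have supp: "{\<beta>. multiindex_le \<beta> \<alpha> \<and> e' \<beta> \<noteq> 0} \<subseteq> ?B"
    by (auto simp: e'_def)
  have le: "multiindex_le \<beta> \<alpha>" if "\<beta> \<in> ?B" for \<beta>
    using that by (intro multiindex_le_trans[OF _ a]) (auto simp: PiE_iff)
  have "interpolate smul C UNIV f x =
      (\<Sum>\<beta> | multiindex_le \<beta> \<alpha> \<and> e' \<beta> \<noteq> 0. smul (\<Prod>i\<in>UNIV. (x $ i) ^ \<beta> i) (e' \<beta>))"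
    if x: "x \<in> V" for x
  proof -
    have C: "C i (x $ i) = ?D i" for i
      using V[OF x] x0 by (intro local_interpolation.nodes_eq[OF coord]) auto
    have "(\<Prod>i\<in>UNIV. lagrange_basis (?D i) (c i) (x $ i)) =
        (\<Sum>\<beta>\<in>?B. \<Prod>i\<in>UNIV. l (i, c i) (\<beta> i) * (x $ i) ^ \<beta> i)" if "c \<in> PiE UNIV ?D" for c
    proof -
      have "(\<Prod>i\<in>UNIV. lagrange_basis (?D i) (c i) (x $ i)) =
          (\<Prod>i\<in>UNIV. \<Sum>m\<le>a i. l (i, c i) m * (x $ i) ^ m)"
        using that by (intro prod.cong refl l) (auto simp: PiE_iff)
      also have "\<dots> = (\<Sum>\<beta>\<in>?B. \<Prod>i\<in>UNIV. l (i, c i) (\<beta> i) * (x $ i) ^ \<beta> i)"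
        by (rule prod_sum_PiE) auto
      finally show ?thesis .
    qed
    then have "interpolate smul C UNIV f x = (\<Sum>c\<in>PiE UNIV ?D.
        \<Sum>\<beta>\<in>?B. smul (\<Prod>i\<in>UNIV. (x $ i) ^ \<beta> i) (smul (\<Prod>i\<in>UNIV. l (i, c i) (\<beta> i)) (f (vec_lambda c))))"
      unfolding interpolate_def C
      by (intro sum.cong refl) (simp add: scale_sum_left prod.distrib mult.commute)
    also have "\<dots> = (\<Sum>\<beta>\<in>?B. smul (\<Prod>i\<in>UNIV. (x $ i) ^ \<beta> i) (e \<beta>))"
      unfolding e_def scale_sum_right by (rule sum.swap)
    also have "\<dots> = (\<Sum>\<beta>\<in>?B. smul (\<Prod>i\<in>UNIV. (x $ i) ^ \<beta> i) (e' \<beta>))"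
      by (intro sum.cong) (auto simp: e'_def)
    also have "\<dots> = (\<Sum>\<beta> | multiindex_le \<beta> \<alpha> \<and> e' \<beta> \<noteq> 0. smul (\<Prod>i\<in>UNIV. (x $ i) ^ \<beta> i) (e' \<beta>))"
      using finB supp le by (intro sum.mono_neutral_right) auto
    finally show ?thesis .
  qed
  moreover have "finite {\<beta>. multiindex_le \<beta> \<alpha> \<and> e' \<beta> \<noteq> 0}"
    using supp finB by (rule finite_subset)
  ultimately show ?thesis
    unfolding polynomial_on_def by blast
qed

lemma restrict_interpolate_LocPol:
  assumes a: "multiindex_le a \<alpha>" and A: "A = factor U"
  shows "restrict (interpolate smul C UNIV f) U \<in> LocPol smul \<alpha> U"
  unfolding LocPol_def
proof (intro CollectI conjI ballI)
  fix x0 assume x0: "x0 \<in> U"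
  have \<delta>: "0 < \<delta>"
    using local_interpolation.\<delta>(1)[OF coord] .
  let ?T = "\<Inter>i. {x. x $ i \<in> ball (x0 $ i) \<delta>}"
  have "open ?T"
    by (intro open_INT ballI open_vimage_vec_nth[unfolded vimage_def] open_ball finite)
  then have "openin (top_of_set U) (U \<inter> ?T)"
    by (rule openin_open_Int)
  moreover have "polynomial_on smul \<alpha> (U \<inter> ?T) (interpolate smul C UNIV f)"
    using x0 by (intro interpolate_polynomial[OF a, of x0]) (auto simp: A dist_commute less_imp_le)
  then have "polynomial_on smul \<alpha> (U \<inter> ?T) (restrict (interpolate smul C UNIV f) U)"
    by (simp add: polynomial_on_def)
  ultimately show "\<exists>V. openin (top_of_set U) V \<and> x0 \<in> V \<and>
      polynomial_on smul \<alpha> V (restrict (interpolate smul C UNIV f) U)"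
    using x0 \<delta> by (intro exI[of _ "U \<inter> ?T"]) auto
qed simp

end

section \<open>Approximation measured by open submodules, and neighbourhoods in C^\<alpha>\<close>

context locally_convex_tvs
begin

lemma closed_submodule:
  assumes "open M" "unit_ball_submodule smul M"
  shows "closed M"
  using assms by (intro closed_open_subgroup) (auto simp: unit_ball_submodule_def)

lemma submodule_Int:
  "unit_ball_submodule smul M \<Longrightarrow> unit_ball_submodule smul N \<Longrightarrow> unit_ball_submodule smul (M \<inter> N)"
  by (simp add: unit_ball_submodule_def)

lemma LocPol_approximation:
  fixes U :: "('k ^ 'n::finite) set"
  assumes cU: "compact U" and U: "cartesian U" and f: "f \<in> C_alpha smul \<alpha> U" and a: "multiindex_le a \<alpha>"
    and M: "open M" "unit_ball_submodule smul M"
  obtains p where "p \<in> LocPol smul \<alpha> U" "dd_small smul (factor U) a M (\<lambda>x. f x - p x)"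
proof -
  have "0 \<in> M"
    using M(2) by (simp add: unit_ball_submodule_def)
  then obtain \<delta> where \<delta>: "0 < \<delta>" "\<delta> \<le> 1" and mod:
    "\<And>X i S S' t. admissible (factor U) a (X(i := S)) \<Longrightarrow> admissible (factor U) a (X(i := S')) \<Longrightarrow>
      card S = Suc (a i) \<Longrightarrow> card S' = Suc (a i) \<Longrightarrow> (\<And>s. s \<in> S \<union> S' \<Longrightarrow> dist s t \<le> \<delta>) \<Longrightarrow>
      mdd smul f (X(i := S)) - mdd smul f (X(i := S')) \<in> M"
    using uniform_modulus[OF cU f a M(1)] by blast
  have "\<forall>i. \<exists>C. (\<forall>t\<in>factor U i. finite (C t) \<and> card (C t) = Suc (a i) \<and> C t \<subseteq> factor U i \<and> (\<forall>s\<in>C t. dist s t \<le> \<delta>)) \<and>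
    (\<forall>s t. dist s t \<le> \<delta> \<longrightarrow> C s = C t)"
    using infinite_ball_factor[OF U] by (intro allI exists_interpolation_nodes \<delta>(1))
  from choice[OF this] obtain C where C:
    "\<forall>i. (\<forall>t\<in>factor U i. finite (C i t) \<and> card (C i t) = Suc (a i) \<and> C i t \<subseteq> factor U i \<and> (\<forall>s\<in>C i t. dist s t \<le> \<delta>)) \<and>
    (\<forall>s t. dist s t \<le> \<delta> \<longrightarrow> C i s = C i t)"
    by blast
  interpret grid_interpolation smul "factor U" \<delta> a C
  proof (rule grid_interpolation.intro[OF ultrametric_vector_space_axioms], rule grid_interpolation_axioms.intro)
    fix i
    show "local_interpolation smul (factor U i) \<delta> (a i) (C i)"
      using \<delta> C[rule_format, of i] by unfold_locales blast+
  qed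
  let ?p = "restrict (interpolate smul C UNIV f) U"
  have small: "dd_small smul (factor U) a M (\<lambda>x. f x - interpolate smul C UNIV f x)"
    by (rule dd_small_interpolate_error[OF M(2)]) (rule mod; assumption)
  have "dd_small smul (factor U) a M (\<lambda>x. f x - ?p x)"
    unfolding dd_small_def
  proof (intro allI impI)
    fix X assume X: "admissible (factor U) a X"
    \<comment> \<open>Grids of admissible sets lie in the cartesian set \<open>U\<close>, so
      restricting the interpolant to \<open>U\<close> does not change its divided
      differences.\<close>
    have "mdd smul (\<lambda>x. f x - ?p x) X = mdd smul (\<lambda>x. f x - interpolate smul C UNIV f x) X"
    proof (rule mdd_cong)
      fix c assume "\<And>i. c i \<in> X i"
      then have "vec_lambda c \<in> U"
        using X unfolding mem_cartesian_iff[OF U] admissible_def by auto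
      then show "f (vec_lambda c) - ?p (vec_lambda c) = f (vec_lambda c) - interpolate smul C UNIV f (vec_lambda c)"
        by simp
    qed
    then show "mdd smul (\<lambda>x. f x - ?p x) X \<in> M"
      using small X by (simp add: dd_small_def)
  qed
  then show thesis
    using that restrict_interpolate_LocPol[OF a refl] by blast
qed

lemma dd_extension_close:
  fixes U :: "('k ^ 'n::finite) set"
  assumes f: "f \<in> C_alpha smul \<alpha> U" and p: "p \<in> C_alpha smul \<alpha> U" and \<beta>: "multiindex_le \<beta> \<alpha>"
    and V: "cartesian V" "V \<subseteq> U" and M: "open M" "unit_ball_submodule smul M"
    and small: "dd_small smul (factor U) \<beta> M (\<lambda>x. f x - p x)" and x: "x \<in> node_space \<beta> V"
  shows "dd_extension smul \<beta> V (restrict f V) x - dd_extension smul \<beta> V (restrict p V) x \<in> M"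
proof (rule mem_closed_of_distinct[OF V(1) _ closed_submodule[OF M] _ x])
  let ?F = "dd_extension smul \<beta> V (restrict f V)" and ?P = "dd_extension smul \<beta> V (restrict p V)"
  have ext: "is_dd_extension smul \<beta> V (restrict f V) ?F" "is_dd_extension smul \<beta> V (restrict p V) ?P"
    using is_dd_extension_dd_extension \<beta> V f p by blast+
  then show "continuous_on (node_space \<beta> V) (\<lambda>x. ?F x - ?P x)"
    by (intro continuous_on_diff) (auto simp: is_dd_extension_def continuous_maps_def)
  fix x assume x: "x \<in> distinct_node_space \<beta> V"
  then have xU: "x \<in> distinct_node_space \<beta> U"
    using distinct_node_space_mono[OF V(2)] by blast
  have eq: "divided_difference smul \<beta> (restrict h V) x = mdd smul h (\<lambda>i. x i ` {..\<beta> i})" for h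
    using divided_difference_cong[OF V(1) x, of "restrict h V" h] divided_difference_eq_mdd'[OF x, of h] by simp
  have "?F x - ?P x = mdd smul f (\<lambda>i. x i ` {..\<beta> i}) - mdd smul p (\<lambda>i. x i ` {..\<beta> i})"
    using ext x by (simp add: is_dd_extension_def eq)
  also have "\<dots> = mdd smul (\<lambda>x. f x - p x) (\<lambda>i. x i ` {..\<beta> i})"
    by (simp add: mdd_diff)
  also have "\<dots> \<in> M"
  proof -
    have "admissible (factor U) \<beta> (\<lambda>i. x i ` {..\<beta> i})"
      using xU unfolding admissible_def
      by (auto simp: mem_distinct_node_space mem_node_space card_image)
    then show ?thesis
      using small unfolding dd_small_def by blast
  qed
  finally show "?F x - ?P x \<in> M" .
qed

lemma compact_open_neighbourhood:
  assumes W: "openin (compact_open_topology X) W" and g: "g \<in> W"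
  shows "\<exists>M. open M \<and> unit_ball_submodule smul M \<and>
    (\<forall>h\<in>continuous_maps X. (\<forall>x\<in>X. g x - h x \<in> M) \<longrightarrow> h \<in> W)"
  using W[unfolded compact_open_topology_def openin_topology_generated_by_iff] g
proof (induction W rule: generate_topology_on.induct)
  case (Int W1 W2)
  from Int.IH(1)[OF IntD1[OF Int.prems]] obtain M where M: "open M" "unit_ball_submodule smul M"
      "\<And>h. h \<in> continuous_maps X \<Longrightarrow> (\<forall>x\<in>X. g x - h x \<in> M) \<Longrightarrow> h \<in> W1"
    by blast
  from Int.IH(2)[OF IntD2[OF Int.prems]] obtain N where N: "open N" "unit_ball_submodule smul N"
      "\<And>h. h \<in> continuous_maps X \<Longrightarrow> (\<forall>x\<in>X. g x - h x \<in> N) \<Longrightarrow> h \<in> W2"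
    by blast
  have "h \<in> W1 \<inter> W2" if "h \<in> continuous_maps X" "\<forall>x\<in>X. g x - h x \<in> M \<inter> N" for h
    using M(3)[OF that(1)] N(3)[OF that(1)] that(2) by blast
  then show ?case
    using open_Int[OF M(1) N(1)] submodule_Int[OF M(2) N(2)] by blast
next
  case (UN \<W>)
  then obtain W where W: "W \<in> \<W>" "g \<in> W"
    by blast
  then show ?case
    using UN.IH[OF W] by blast
next
  case (Basis W)
  then obtain K Z where W: "W = {g \<in> continuous_maps X. g ` K \<subseteq> Z}" "compact K" "K \<subseteq> X" "open Z"
    by blast
  have "\<forall>x\<in>K. \<exists>M. open M \<and> unit_ball_submodule smul M \<and> (\<lambda>e. g x + e) ` M \<subseteq> Z"
  proof
    fix x assume "x \<in> K"
    have "open ((\<lambda>e. g x + e) -` Z)"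
      by (intro open_vimage W continuous_on_add continuous_on_const continuous_on_id)
    moreover have "0 \<in> (\<lambda>e. g x + e) -` Z"
      using \<open>x \<in> K\<close> Basis.prems W by auto
    ultimately obtain M where "open M" "unit_ball_submodule smul M" "M \<subseteq> (\<lambda>e. g x + e) -` Z"
      using locally_convex by blast
    then show "\<exists>M. open M \<and> unit_ball_submodule smul M \<and> (\<lambda>e. g x + e) ` M \<subseteq> Z"
      by (intro exI[of _ M]) auto
  qed
  from bchoice[OF this] obtain M where M: "\<And>x. x \<in> K \<Longrightarrow> open (M x)"
    "\<And>x. x \<in> K \<Longrightarrow> unit_ball_submodule smul (M x)" "\<And>x. x \<in> K \<Longrightarrow> (\<lambda>e. g x + e) ` M x \<subseteq> Z"
    by blast
  have gK: "compact (g ` K)"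
    using Basis.prems W by (intro compact_continuous_image) (auto simp: continuous_maps_def intro: continuous_on_subset)
  have op: "open ((\<lambda>e. e - g x) -` M x)" if "x \<in> K" for x
    using M(1)[OF that] by (intro open_vimage continuous_on_diff continuous_on_const continuous_on_id)
  have cover: "g ` K \<subseteq> (\<Union>x\<in>K. (\<lambda>e. e - g x) -` M x)"
    using M(2) by (fastforce simp: unit_ball_submodule_def)
  obtain K' where K': "K' \<subseteq> K" "finite K'" "g ` K \<subseteq> (\<Union>x\<in>K'. (\<lambda>e. e - g x) -` M x)"
    by (rule compactE_image[OF gK op cover])
  show ?case
  proof (intro exI conjI ballI impI)
    show "open (\<Inter>x\<in>K'. M x)"
      using M(1) K' by (intro open_INT) auto
    show "unit_ball_submodule smul (\<Inter>x\<in>K'. M x)"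
      using M(2) K'(1) unfolding unit_ball_submodule_def by blast
    fix h assume h: "h \<in> continuous_maps X" "\<forall>x\<in>X. g x - h x \<in> (\<Inter>x\<in>K'. M x)"
    have "h y \<in> Z" if "y \<in> K" for y
    proof -
      obtain x where x: "x \<in> K'" "g y - g x \<in> M x"
        using K'(3) \<open>y \<in> K\<close> by blast
      then have "x \<in> K" "g y - h y \<in> M x"
        using K'(1) h(2) \<open>y \<in> K\<close> W(3) by auto
      \<comment> \<open>This difference is \<open>h y - g x\<close>. The submodule attached to
        \<open>x\<close> absorbs both errors without being halved.\<close>
      then have "(g y - g x) - (g y - h y) \<in> M x"
        using submodule_diff[OF M(2) x(2)] by blast
      then have "g x + ((g y - g x) - (g y - h y)) \<in> Z"
        using M(3)[OF \<open>x \<in> K\<close>] by blast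
      then show ?thesis
        by simp
    qed
    then show "h \<in> W"
      using h(1) W(1) by auto
  qed
qed auto

text \<open>Each subbasic set involves a single order \<beta> and a part \<open>V\<close> of
  \<open>U\<close>. The divided differences on \<open>V\<close> are among those on \<open>U\<close>,
  so closeness on \<open>U\<close> up to order \<beta> suffices.\<close>

lemma C_alpha_neighbourhood:
  fixes U :: "('k ^ 'n::finite) set"
  assumes T: "openin (C_alpha_topology smul \<alpha> U) T" and f: "f \<in> T" "f \<in> C_alpha smul \<alpha> U"
  shows "\<exists>a M. multiindex_le a \<alpha> \<and> open M \<and> unit_ball_submodule smul M \<and>
    (\<forall>p\<in>C_alpha smul \<alpha> U. dd_small smul (factor U) a M (\<lambda>x. f x - p x) \<longrightarrow> p \<in> T)"
  using T[unfolded C_alpha_topology_def openin_topology_generated_by_iff] f(1)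
proof (induction T rule: generate_topology_on.induct)
  case (Int T1 T2)
  from Int.IH(1)[OF IntD1[OF Int.prems]] obtain a M where
    a: "multiindex_le a \<alpha>" "open M" "unit_ball_submodule smul M"
    "\<And>p. p \<in> C_alpha smul \<alpha> U \<Longrightarrow> dd_small smul (factor U) a M (\<lambda>x. f x - p x) \<Longrightarrow> p \<in> T1"
    by blast
  from Int.IH(2)[OF IntD2[OF Int.prems]] obtain b N where b: "multiindex_le b \<alpha>" "open N" "unit_ball_submodule smul N"
    "\<And>p. p \<in> C_alpha smul \<alpha> U \<Longrightarrow> dd_small smul (factor U) b N (\<lambda>x. f x - p x) \<Longrightarrow> p \<in> T2"
    by blast
  \<comment> \<open>The componentwise maximum of two finite orders below \<alpha> is again finite
    and below \<alpha>, and closeness up to it implies both requirements.\<close>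
  let ?c = "\<lambda>i. max (a i) (b i)"
  have "multiindex_le ?c \<alpha>"
    using a(1) b(1) by (simp add: multiindex_le_def max_def)
  moreover have "p \<in> T1 \<inter> T2" if "p \<in> C_alpha smul \<alpha> U" "dd_small smul (factor U) ?c (M \<inter> N) (\<lambda>x. f x - p x)" for p
    using a(4)[OF that(1) dd_small_mono[OF that(2)]] b(4)[OF that(1) dd_small_mono[OF that(2)]] by simp
  ultimately show ?case
    using a(2,3) b(2,3) by (intro exI[of _ ?c] exI[of _ "M \<inter> N"]) (auto intro: submodule_Int)
next
  case (UN \<T>)
  then obtain T where T: "T \<in> \<T>" "f \<in> T"
    by blast
  then show ?case
    using UN.IH[OF T] by blast
next
  case (Basis T)
  then obtain \<beta> V W where T: "T = {f \<in> C_alpha smul \<alpha> U. dd_extension smul \<beta> V (restrict f V) \<in> W}"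
    and \<beta>: "multiindex_le \<beta> \<alpha>" and V: "cartesian V" "openin (top_of_set U) V"
    and W: "openin (compact_open_topology (node_space \<beta> V)) W"
    by blast
  have VU: "V \<subseteq> U"
    using V(2) openin_imp_subset by blast
  have "dd_extension smul \<beta> V (restrict f V) \<in> W"
    using Basis.prems T by blast
  from compact_open_neighbourhood[OF W this] obtain M where M: "open M" "unit_ball_submodule smul M"
    "\<And>h. h \<in> continuous_maps (node_space \<beta> V) \<Longrightarrow>
      (\<And>x. x \<in> node_space \<beta> V \<Longrightarrow> dd_extension smul \<beta> V (restrict f V) x - h x \<in> M) \<Longrightarrow> h \<in> W"
    by blast
  have "p \<in> T" if p: "p \<in> C_alpha smul \<alpha> U" "dd_small smul (factor U) \<beta> M (\<lambda>x. f x - p x)" for p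
  proof -
    have "dd_extension smul \<beta> V (restrict p V) \<in> W"
    proof (rule M(3))
      show "dd_extension smul \<beta> V (restrict p V) \<in> continuous_maps (node_space \<beta> V)"
        using is_dd_extension_dd_extension[OF p(1) \<beta> V(1) VU] by (simp add: is_dd_extension_def)
    qed (rule dd_extension_close[OF f(2) p(1) \<beta> V(1) VU M(1,2) p(2)])
    then show ?thesis
      using p(1) T by blast
  qed
  then show ?case
    using \<beta> M(1,2) by blast
qed auto

end

theorem theoremB:
  fixes smul :: "'k::{ultrametric_field, complete_space} \<Rightarrow> 'e::{topological_ab_group_add, t2_space} \<Rightarrow> 'e"
    and U :: "('k ^ 'n::finite) set"
    and \<alpha> :: "'n \<Rightarrow> enat"
  assumes "locally_convex_tvs smul"
    and "compact U"
    and "cartesian U"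
  shows "LocPol smul \<alpha> U \<subseteq> C_alpha smul \<alpha> U \<and>
         C_alpha_topology smul \<alpha> U closure_of LocPol smul \<alpha> U = C_alpha smul \<alpha> U"
proof -
  interpret locally_convex_tvs smul
    by fact
  have sub: "LocPol smul \<alpha> U \<subseteq> C_alpha smul \<alpha> U"
    using assms(2,3) by (rule LocPol_subset_C_alpha)
  have "f \<in> C_alpha_topology smul \<alpha> U closure_of LocPol smul \<alpha> U" if f: "f \<in> C_alpha smul \<alpha> U" for f
    unfolding in_closure_of
  proof (intro conjI allI impI)
    show "f \<in> topspace (C_alpha_topology smul \<alpha> U)"
      using f by (simp add: topspace_C_alpha_topology[OF assms(3)])
    fix T assume T: "f \<in> T \<and> openin (C_alpha_topology smul \<alpha> U) T"
    from C_alpha_neighbourhood[of \<alpha> U T f] T f obtain a M where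
      a: "multiindex_le a \<alpha>" "open M" "unit_ball_submodule smul M" and
      aT: "\<And>p. p \<in> C_alpha smul \<alpha> U \<Longrightarrow> dd_small smul (factor U) a M (\<lambda>x. f x - p x) \<Longrightarrow> p \<in> T"
      by blast
    obtain p where "p \<in> LocPol smul \<alpha> U" "dd_small smul (factor U) a M (\<lambda>x. f x - p x)"
      using LocPol_approximation[OF assms(2,3) f a] by blast
    then show "\<exists>p. p \<in> LocPol smul \<alpha> U \<and> p \<in> T"
      using aT sub by blast
  qed
  moreover have "C_alpha_topology smul \<alpha> U closure_of LocPol smul \<alpha> U \<subseteq> C_alpha smul \<alpha> U"
    using closure_of_subset_topspace topspace_C_alpha_topology[OF assms(3)] by metis
  ultimately show ?thesis
    using sub by blast
qed

end
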